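(* Let $k\ge1$ be an integer, let $\kappa$ be a $C^\infty$ function germ at $0\in\mathbb{R}$, let $\theta(s)=\int_0^s\kappa(u)\,du$ with Taylor expansion $\sum_{i\ge1}\theta_i s^i/i!$, and let $\phi_2(s)=\int_0^s u\,(\cos\theta(u),\sin\theta(u))\,du$. The map germ $\phi_2$ defines an $A_{2k}$ singularity at $0$ if and only if $$\theta_i=0\ \text{ for all } i\ge1 \text{ with } i\not\equiv0\bmod2,\ i<2k-1,\qquad\text{and}\qquad \theta_{2k-1}\ne0.$$ If these conditions hold, $\phi_2$ is $\mathcal L$-equivalent to $(t^2,t^{2k+1})$ at $0$.
   Context: Two $C^\infty$ map germs $f,g:(\mathbb{R},0)\to(\mathbb{R}^2,0)$ are $\mathcal A$-equivalent if there are diffeomorphism germs $h$ of $(\mathbb{R},0)$ and $\psi$ of $(\mathbb{R}^2,0)$ with $f\circ h=\psi\circ g$; they are $\mathcal L$-equivalent if one can take $h=\mathrm{id}$, i.e. $f=\psi\circ g$. A map germ $(\mathbb{R},0)\to(\mathbb{R}^2,0)$ defines an $A_{2k}$ singularity at $0$ if it is $\mathcal A$-equivalent to $t\mapsto(t^2,t^{2k+1})$. *)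

theory Defs
  imports "HOL-Analysis.Analysis"
begin

text \<open>
  Map germs are given by representatives, that is, total functions of which only the
  values near the base point matter.
\<close>

text \<open>
  On an open set \<open>U\<close>, \<open>Ck_on n U f\<close> says that \<open>f\<close> is of class \<open>C\<^sup>n\<close>: it is differentiable
  and all of its directional derivatives are of class \<open>C\<^sup>n\<^sup>-\<^sup>1\<close>. In finite dimension this is
  the usual notion.
\<close>

primrec Ck_on :: "nat \<Rightarrow> 'a set \<Rightarrow> ('a::euclidean_space \<Rightarrow> 'b::euclidean_space) \<Rightarrow> bool" where
  "Ck_on 0 U f \<longleftrightarrow> continuous_on U f"
| "Ck_on (Suc n) U f \<longleftrightarrow>
     (\<forall>x\<in>U. f differentiable (at x)) \<and> (\<forall>v. Ck_on n U (\<lambda>x. frechet_derivative f (at x) v))"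

definition smooth_on :: "'a set \<Rightarrow> ('a::euclidean_space \<Rightarrow> 'b::euclidean_space) \<Rightarrow> bool" where
  "smooth_on U f \<longleftrightarrow> (\<forall>n. Ck_on n U f)"

definition smooth_germ :: "('a::euclidean_space \<Rightarrow> 'b::euclidean_space) \<Rightarrow> bool" where
  "smooth_germ f \<longleftrightarrow> (\<exists>U. open U \<and> 0 \<in> U \<and> smooth_on U f)"

definition smooth_map_germ :: "('a::euclidean_space \<Rightarrow> 'b::euclidean_space) \<Rightarrow> bool" where
  "smooth_map_germ f \<longleftrightarrow> smooth_germ f \<and> f 0 = 0"

definition diffeo_germ :: "('a::euclidean_space \<Rightarrow> 'a) \<Rightarrow> bool" where
  "diffeo_germ h \<longleftrightarrow> h 0 = 0 \<and>
     (\<exists>U V h'. open U \<and> 0 \<in> U \<and> open V \<and> homeomorphism U V h h' \<and> smooth_on U h \<and> smooth_on V h')"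

definition A_equivalent :: "(real \<Rightarrow> real \<times> real) \<Rightarrow> (real \<Rightarrow> real \<times> real) \<Rightarrow> bool" where
  "A_equivalent f g \<longleftrightarrow> smooth_map_germ f \<and> smooth_map_germ g \<and>
     (\<exists>h \<psi>. diffeo_germ h \<and> diffeo_germ \<psi> \<and> (\<forall>\<^sub>F t in nhds 0. f (h t) = \<psi> (g t)))"

definition L_equivalent :: "(real \<Rightarrow> real \<times> real) \<Rightarrow> (real \<Rightarrow> real \<times> real) \<Rightarrow> bool" where
  "L_equivalent f g \<longleftrightarrow> smooth_map_germ f \<and> smooth_map_germ g \<and>
     (\<exists>\<psi>. diffeo_germ \<psi> \<and> (\<forall>\<^sub>F t in nhds 0. f t = \<psi> (g t)))"

definition A_even_singularity :: "nat \<Rightarrow> (real \<Rightarrow> real \<times> real) \<Rightarrow> bool" where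
  "A_even_singularity k f \<longleftrightarrow> A_equivalent f (\<lambda>t. (t ^ 2, t ^ (2 * k + 1)))"

text \<open>The interval integrals below are signed: for \<open>s < 0\<close> they are minus the integral over \<open>(s, 0)\<close>.\<close>

definition theta :: "(real \<Rightarrow> real) \<Rightarrow> real \<Rightarrow> real" where
  "theta \<kappa> s = (LBINT u=0..s. \<kappa> u)"

definition theta_coeff :: "(real \<Rightarrow> real) \<Rightarrow> nat \<Rightarrow> real" where
  "theta_coeff \<kappa> i = (deriv ^^ i) (theta \<kappa>) 0"

definition phi2 :: "(real \<Rightarrow> real) \<Rightarrow> real \<Rightarrow> real \<times> real" where
  "phi2 \<kappa> s = (LBINT u=0..s. u *\<^sub>R (cos (theta \<kappa> u), sin (theta \<kappa> u)))"

end

theory Submission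
  imports Defs
begin

text \<open>
  Split \<open>phi2\<close> into its even and odd parts. By Whitney's theorem on even functions, if the odd
  coefficients of \<open>theta\<close> below \<open>2m - 1\<close> vanish then
  \<open>phi2 s = A (s\<^sup>2) + s\<^sup>2\<^sup>m\<^sup>+\<^sup>1 B (s\<^sup>2) = \<Psi> (s\<^sup>2, s\<^sup>2\<^sup>m\<^sup>+\<^sup>1)\<close> with \<open>\<Psi> (X, Y) = A X + Y B X\<close>, and the derivative
  of \<open>\<Psi>\<close> at \<open>0\<close> is \<open>diag (1/2, c)\<close> with \<open>c\<close> a nonzero multiple of the coefficient of index \<open>2m - 1\<close>.
  For \<open>m = k\<close> and \<open>c \<noteq> 0\<close> the inverse function theorem makes \<open>\<Psi>\<close> the required diffeomorphism.
  Conversely, let \<open>phi2 (h t) = \<psi> (t\<^sup>2, t\<^sup>2\<^sup>k\<^sup>+\<^sup>1)\<close> and \<open>m \<le> k\<close>. Comparing the odd parts in \<open>t\<close> of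
  both sides to order \<open>2m + 1\<close> shows that \<open>c \<noteq> 0\<close> exactly for \<open>m = k\<close>; induction on \<open>m\<close> finishes
  the proof.
\<close>

subsection \<open>Calculus of smooth maps\<close>

text \<open>\<open>\<Psi>\<close> has a diagonal derivative because \<open>theta \<kappa>\<close>
  vanishes at 0: there \<open>phi2 \<kappa>\<close> starts with \<open>(s^2 / 2, 0)\<close>, and the
  odd part of its first component is of higher order than that of the second. The converse meets two
  obstacles. The map \<open>\<psi>\<close> may mix the coordinates, so its derivative
  \<open>E\<close> must first be shown to send \<open>(1, 0)\<close> to a horizontal vector;
  injectivity then makes the second component of \<open>E (0, 1)\<close> nonzero, and
  \<open>c\<close> is compared with it. Moreover \<open>h\<close> need not be odd, so
  \<open>h(t)^2 - h(-t)^2\<close> does not cancel and its size is not known in advance. It is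
  controlled through the first component of \<open>\<Psi>\<close>, whose factor \<open>1/2\<close>
  is available even when \<open>c = 0\<close>.\<close>

lemma Ck_on_cong:
  assumes "open U" "\<And>x. x \<in> U \<Longrightarrow> f x = g x"
  shows "Ck_on n U f \<longleftrightarrow> Ck_on n U g"
proof -
  have "Ck_on n U g" if "Ck_on n U f" "\<And>x. x \<in> U \<Longrightarrow> f x = g x" for f g :: "'a \<Rightarrow> 'b"
    using that
  proof (induction n arbitrary: f g)
    case 0
    then show ?case by (simp cong: continuous_on_cong)
  next
    case (Suc n)
    have diff: "f differentiable (at x)" if "x \<in> U" for x
      using Suc.prems(1) that by simp
    have "g differentiable (at x)" if "x \<in> U" for x
      using diff[OF that] that \<open>open U\<close> Suc.prems(2)
      by (meson differentiable_def has_derivative_transform_within_open)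
    moreover have "Ck_on n U (\<lambda>x. frechet_derivative g (at x) v)" for v
    proof (rule Suc.IH)
      show "Ck_on n U (\<lambda>x. frechet_derivative f (at x) v)"
        using Suc.prems(1) by simp
      show "frechet_derivative f (at x) v = frechet_derivative g (at x) v" if "x \<in> U" for x
        using frechet_derivative_transform_within_open[OF diff[OF that] \<open>open U\<close> that Suc.prems(2)]
        by simp
    qed
    ultimately show ?case by simp
  qed
  then show ?thesis using assms by metis
qed

lemma Ck_on_SucI:
  assumes "open U"
    and "\<And>x. x \<in> U \<Longrightarrow> (f has_derivative f' x) (at x)"
    and "\<And>v. Ck_on n U (\<lambda>x. f' x v)"
  shows "Ck_on (Suc n) U f"
proof -
  have "Ck_on n U (\<lambda>x. frechet_derivative f (at x) v)" for v
    using Ck_on_cong[OF \<open>open U\<close>, of "\<lambda>x. f' x v" "\<lambda>x. frechet_derivative f (at x) v"]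
      assms(2,3) frechet_derivative_at by metis
  then show ?thesis using assms(2) by (auto simp: differentiable_def)
qed

lemma Ck_on_SucD:
  assumes "Ck_on (Suc n) U f"
  shows "\<And>x. x \<in> U \<Longrightarrow> (f has_derivative frechet_derivative f (at x)) (at x)"
    and "\<And>v. Ck_on n U (\<lambda>x. frechet_derivative f (at x) v)"
  using assms frechet_derivative_works by auto

lemma Ck_on_continuous: "Ck_on n U f \<Longrightarrow> continuous_on U f"
  by (cases n) (auto intro!: continuous_at_imp_continuous_on differentiable_imp_continuous_within)

lemma Ck_on_Suc_weaken: "Ck_on (Suc n) U f \<Longrightarrow> Ck_on n U f"
proof (induction n arbitrary: f)
  case 0
  then show ?case using Ck_on_continuous by (metis Ck_on.simps(1))
next
  case (Suc n)
  then show ?case by (meson Ck_on.simps(2))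
qed

lemma Ck_on_subset: "Ck_on n U f \<Longrightarrow> V \<subseteq> U \<Longrightarrow> Ck_on n V f"
  by (induction n arbitrary: f) (auto intro: continuous_on_subset)

lemma Ck_on_const: "open U \<Longrightarrow> Ck_on n U (\<lambda>x. c)"
proof (induction n arbitrary: c)
  case (Suc n)
  then show ?case by (intro Ck_on_SucI[where f' = "\<lambda>_ _. 0"]) auto
qed simp

lemma Ck_on_linear:
  assumes "open U" "bounded_linear L"
  shows "Ck_on n U L"
proof (cases n)
  case 0
  then show ?thesis using assms by (simp add: linear_continuous_on)
next
  case (Suc m)
  show ?thesis
    unfolding Suc
    by (rule Ck_on_SucI[where f' = "\<lambda>_. L"])
      (auto intro: assms Ck_on_const bounded_linear_imp_has_derivative)
qed

lemma Ck_on_add: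
  assumes "open U"
  shows "Ck_on n U f \<Longrightarrow> Ck_on n U g \<Longrightarrow> Ck_on n U (\<lambda>x. f x + g x)"
proof (induction n arbitrary: f g)
  case 0
  then show ?case by (auto intro: continuous_intros)
next
  case (Suc n)
  note f = Ck_on_SucD[OF Suc.prems(1)] and g = Ck_on_SucD[OF Suc.prems(2)]
  show ?case
    by (rule Ck_on_SucI[OF assms has_derivative_add[OF f(1) g(1)] Suc.IH[OF f(2) g(2)]])
qed

lemma Ck_on_sum:
  assumes "open U" "\<And>i. i \<in> I \<Longrightarrow> Ck_on n U (f i)"
  shows "Ck_on n U (\<lambda>x. \<Sum>i\<in>I. f i x)"
  using assms(2)
proof (induction I rule: infinite_finite_induct)
  case (insert i I)
  then show ?case using Ck_on_add[OF assms(1), of n "f i" "\<lambda>x. \<Sum>i\<in>I. f i x"] by simp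
qed (use Ck_on_const[OF assms(1), of n 0] in auto)

lemma Ck_on_bilinear:
  assumes "open U" "bounded_bilinear B"
  shows "Ck_on n U f \<Longrightarrow> Ck_on n U g \<Longrightarrow> Ck_on n U (\<lambda>x. B (f x) (g x))"
proof (induction n arbitrary: f g)
  case 0
  then show ?case using bounded_bilinear.continuous_on[OF assms(2)] by auto
next
  case (Suc n)
  note f = Ck_on_SucD[OF Suc.prems(1)] and g = Ck_on_SucD[OF Suc.prems(2)]
  show ?case
  proof (rule Ck_on_SucI[OF assms(1)])
    show "((\<lambda>x. B (f x) (g x)) has_derivative
        (\<lambda>h. B (f x) (frechet_derivative g (at x) h) + B (frechet_derivative f (at x) h) (g x))) (at x)"
      if "x \<in> U" for x
      using bounded_bilinear.FDERIV[OF assms(2) f(1)[OF that] g(1)[OF that]] .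
    show "Ck_on n U (\<lambda>x. B (f x) (frechet_derivative g (at x) v) +
        B (frechet_derivative f (at x) v) (g x))" for v
      using Suc.prems f(2) g(2)
      by (intro Ck_on_add[OF assms(1)] Suc.IH) (auto intro: Ck_on_Suc_weaken)
  qed
qed

text \<open>In the chain rule the direction \<open>frechet_derivative g (at x) v\<close> moves with
  \<open>x\<close>, whereas \<open>Ck_on\<close> speaks of fixed directions. Expanding it in
  \<open>Basis\<close> leaves a finite sum of scalar coefficients times derivatives of
  \<open>f\<close> in fixed directions composed with \<open>g\<close>, which the induction
  hypothesis covers.\<close>

lemma Ck_on_compose:
  assumes "open U" "open V"
  shows "Ck_on n V f \<Longrightarrow> Ck_on n U g \<Longrightarrow> g ` U \<subseteq> V \<Longrightarrow> Ck_on n U (\<lambda>x. f (g x))"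
proof (induction n arbitrary: f g)
  case 0
  then show ?case by (auto intro: continuous_on_compose2)
next
  case (Suc n)
  note f = Ck_on_SucD[OF Suc.prems(1)] and g = Ck_on_SucD[OF Suc.prems(2)]
  show ?case
  proof (rule Ck_on_SucI[OF assms(1)])
    fix x assume x: "x \<in> U"
    then have gx: "g x \<in> V" using Suc.prems(3) by auto
    have lin: "linear (frechet_derivative f (at (g x)))"
      using f(1)[OF gx] has_derivative_linear by blast
    have "((\<lambda>x. f (g x)) has_derivative
        (\<lambda>h. frechet_derivative f (at (g x)) (frechet_derivative g (at x) h))) (at x)"
      using has_derivative_compose[OF g(1)[OF x] f(1)[OF gx]] .
    also have "(\<lambda>h. frechet_derivative f (at (g x)) (frechet_derivative g (at x) h)) =
        (\<lambda>h. \<Sum>b\<in>Basis. (frechet_derivative g (at x) h \<bullet> b) *\<^sub>R frechet_derivative f (at (g x)) b)"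
    proof
      fix h
      have "frechet_derivative f (at (g x)) (frechet_derivative g (at x) h) =
          frechet_derivative f (at (g x)) (\<Sum>b\<in>Basis. (frechet_derivative g (at x) h \<bullet> b) *\<^sub>R b)"
        by (simp add: euclidean_representation)
      also have "\<dots> = (\<Sum>b\<in>Basis. (frechet_derivative g (at x) h \<bullet> b) *\<^sub>R
          frechet_derivative f (at (g x)) b)"
        by (simp add: linear_sum[OF lin] linear_scale[OF lin])
      finally show "frechet_derivative f (at (g x)) (frechet_derivative g (at x) h) =
        (\<Sum>b\<in>Basis. (frechet_derivative g (at x) h \<bullet> b) *\<^sub>R frechet_derivative f (at (g x)) b)" .
    qed
    finally show "((\<lambda>x. f (g x)) has_derivative
        (\<lambda>h. \<Sum>b\<in>Basis. (frechet_derivative g (at x) h \<bullet> b) *\<^sub>R frechet_derivative f (at (g x)) b)) (at x)" .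
  next
    fix v
    have "Ck_on n U (\<lambda>x. (frechet_derivative g (at x) v \<bullet> b) *\<^sub>R frechet_derivative f (at (g x)) b)"
      for b
    proof (rule Ck_on_bilinear[OF assms(1) bounded_bilinear_scaleR])
      show "Ck_on n U (\<lambda>x. frechet_derivative g (at x) v \<bullet> b)"
        using Ck_on_bilinear[OF assms(1) bounded_bilinear_inner g(2) Ck_on_const[OF assms(1)]] .
      show "Ck_on n U (\<lambda>x. frechet_derivative f (at (g x)) b)"
        using Suc.IH[OF f(2)[of b] Ck_on_Suc_weaken[OF Suc.prems(2)] Suc.prems(3)] .
    qed
    then show "Ck_on n U (\<lambda>x. \<Sum>b\<in>Basis. (frechet_derivative g (at x) v \<bullet> b) *\<^sub>R
        frechet_derivative f (at (g x)) b)"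
      by (intro Ck_on_sum[OF assms(1)]) auto
  qed
qed

lemma Ck_on_inverse:
  fixes f :: "'a::euclidean_space \<Rightarrow> real"
  assumes "open U" "\<And>x. x \<in> U \<Longrightarrow> f x \<noteq> 0"
  shows "Ck_on n U f \<Longrightarrow> Ck_on n U (\<lambda>x. inverse (f x))"
proof (induction n)
  case 0
  then show ?case using assms by (auto intro: continuous_intros)
next
  case (Suc n)
  note f = Ck_on_SucD[OF Suc.prems]
  note inv = Suc.IH[OF Ck_on_Suc_weaken[OF Suc.prems]]
  note mult = Ck_on_bilinear[OF assms(1) bounded_bilinear_mult]
  show ?case
  proof (rule Ck_on_SucI[OF assms(1)])
    show "((\<lambda>x. inverse (f x)) has_derivative
        (\<lambda>h. (- 1) * (inverse (f x) * frechet_derivative f (at x) h * inverse (f x)))) (at x)"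
      if "x \<in> U" for x
      using Deriv.has_derivative_inverse[OF assms(2)[OF that] f(1)[OF that]] by simp
    show "Ck_on n U (\<lambda>x. (- 1) * (inverse (f x) * frechet_derivative f (at x) v * inverse (f x)))" for v
      by (intro mult inv f(2) Ck_on_const assms(1))
  qed
qed

lemma Ck_on_Pair:
  assumes "open U" "Ck_on n U f" "Ck_on n U g"
  shows "Ck_on n U (\<lambda>x. (f x, g x))"
proof -
  have "Ck_on n U (\<lambda>x. (f x, 0) + (0, g x))"
  proof (rule Ck_on_add[OF assms(1)])
    have "bounded_linear (\<lambda>x::'b. (x, 0::'c))" "bounded_linear (\<lambda>x::'c. (0::'b, x))"
      by (auto intro!: bounded_linear_Pair bounded_linear_ident bounded_linear_zero)
    then show "Ck_on n U (\<lambda>x. (f x, 0::'c))" "Ck_on n U (\<lambda>x. (0::'b, g x))"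
      using Ck_on_compose[OF assms(1) open_UNIV Ck_on_linear[OF open_UNIV] assms(2)]
        Ck_on_compose[OF assms(1) open_UNIV Ck_on_linear[OF open_UNIV] assms(3)] by auto
  qed
  then show ?thesis by simp
qed

section \<open>Closure rules for smooth maps\<close>

lemma smooth_on_cong:
  "open U \<Longrightarrow> (\<And>x. x \<in> U \<Longrightarrow> f x = g x) \<Longrightarrow> smooth_on U f \<longleftrightarrow> smooth_on U g"
  unfolding smooth_on_def using Ck_on_cong by blast

lemma smooth_on_subset: "smooth_on U f \<Longrightarrow> V \<subseteq> U \<Longrightarrow> smooth_on V f"
  unfolding smooth_on_def using Ck_on_subset by blast

lemma smooth_on_continuous: "smooth_on U f \<Longrightarrow> continuous_on U f"
  unfolding smooth_on_def using Ck_on_continuous by blast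

lemma smooth_on_has_derivative:
  "smooth_on U f \<Longrightarrow> x \<in> U \<Longrightarrow> (f has_derivative frechet_derivative f (at x)) (at x)"
  unfolding smooth_on_def using Ck_on_SucD by blast

lemma smooth_on_frechet_derivative:
  "smooth_on U f \<Longrightarrow> smooth_on U (\<lambda>x. frechet_derivative f (at x) v)"
  unfolding smooth_on_def using Ck_on_SucD by blast

lemma smooth_on_const: "open U \<Longrightarrow> smooth_on U (\<lambda>x. c)"
  and smooth_on_linear: "open U \<Longrightarrow> bounded_linear L \<Longrightarrow> smooth_on U L"
  and smooth_on_add: "open U \<Longrightarrow> smooth_on U f \<Longrightarrow> smooth_on U g \<Longrightarrow> smooth_on U (\<lambda>x. f x + g x)"
  and smooth_on_compose: "open U \<Longrightarrow> open V \<Longrightarrow> smooth_on V f' \<Longrightarrow> smooth_on U f \<Longrightarrow> f ` U \<subseteq> V \<Longrightarrow>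
    smooth_on U (\<lambda>x. f' (f x))"
  and smooth_on_Pair: "open U \<Longrightarrow> smooth_on U f \<Longrightarrow> smooth_on U h \<Longrightarrow> smooth_on U (\<lambda>x. (f x, h x))"
  by (simp_all add: smooth_on_def Ck_on_const Ck_on_linear Ck_on_add Ck_on_compose Ck_on_Pair)

lemma smooth_on_scaleR:
  "open U \<Longrightarrow> smooth_on U f \<Longrightarrow> smooth_on U g \<Longrightarrow> smooth_on U (\<lambda>x. f x *\<^sub>R g x)"
  by (simp add: smooth_on_def Ck_on_bilinear[OF _ bounded_bilinear_scaleR])

lemma smooth_on_mult:
  fixes f g :: "'a::euclidean_space \<Rightarrow> real"
  shows "open U \<Longrightarrow> smooth_on U f \<Longrightarrow> smooth_on U g \<Longrightarrow> smooth_on U (\<lambda>x. f x * g x)"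
  by (simp add: smooth_on_def Ck_on_bilinear[OF _ bounded_bilinear_mult])

lemma smooth_on_minus: "open U \<Longrightarrow> smooth_on U f \<Longrightarrow> smooth_on U (\<lambda>x. - f x)"
  using smooth_on_scaleR[OF _ smooth_on_const[of U "- 1 :: real"], of f] by simp

lemma smooth_on_diff:
  "open U \<Longrightarrow> smooth_on U f \<Longrightarrow> smooth_on U g \<Longrightarrow> smooth_on U (\<lambda>x. f x - g x)"
  using smooth_on_add[OF _ _ smooth_on_minus, of U f g] by simp

lemma smooth_on_power:
  fixes f :: "'a::euclidean_space \<Rightarrow> real"
  assumes "open U" "smooth_on U f"
  shows "smooth_on U (\<lambda>x. f x ^ n)"
  by (induction n) (simp_all add: assms smooth_on_const smooth_on_mult)

lemma smooth_on_ident: "open U \<Longrightarrow> smooth_on U (\<lambda>x. x)"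
  using smooth_on_linear[OF _ bounded_linear_ident] .

lemma smooth_on_fst: "open U \<Longrightarrow> smooth_on U f \<Longrightarrow> smooth_on U (\<lambda>x. fst (f x))"
  using smooth_on_compose[OF _ open_UNIV smooth_on_linear[OF open_UNIV bounded_linear_fst]] by auto

lemma smooth_on_snd: "open U \<Longrightarrow> smooth_on U f \<Longrightarrow> smooth_on U (\<lambda>x. snd (f x))"
  using smooth_on_compose[OF _ open_UNIV smooth_on_linear[OF open_UNIV bounded_linear_snd]] by auto

lemmas smooth_on_intros =
  smooth_on_const smooth_on_ident smooth_on_add smooth_on_diff smooth_on_minus smooth_on_mult
  smooth_on_scaleR smooth_on_power smooth_on_Pair smooth_on_fst smooth_on_snd

lemma smooth_on_vector_antiderivative:
  fixes f :: "real \<Rightarrow> 'b::euclidean_space"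
  assumes "open U" "\<And>x. x \<in> U \<Longrightarrow> (f has_vector_derivative f' x) (at x)" "smooth_on U f'"
  shows "smooth_on U f"
  unfolding smooth_on_def
proof
  fix n
  have "Ck_on (Suc n) U f"
  proof (rule Ck_on_SucI[OF assms(1)])
    show "(f has_derivative (\<lambda>v. v *\<^sub>R f' x)) (at x)" if "x \<in> U" for x
      using assms(2)[OF that] by (simp add: has_vector_derivative_def)
    show "Ck_on n U (\<lambda>x. v *\<^sub>R f' x)" for v
      using smooth_on_scaleR[OF assms(1) smooth_on_const[OF assms(1)] assms(3)]
      by (simp add: smooth_on_def)
  qed
  then show "Ck_on n U f" by (rule Ck_on_Suc_weaken)
qed

text \<open>Functions built later by integrals or by pasting come with a candidate for each of their
  derivatives, so smoothness reduces to a single differentiation step checked for every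
  \<open>n\<close>. The induction on the order treats all \<open>F n\<close> at once, since the
  derivative of one member is the next.\<close>

lemma smooth_on_derivative_sequence:
  fixes F :: "nat \<Rightarrow> real \<Rightarrow> real"
  assumes "open U" "\<And>n x. x \<in> U \<Longrightarrow> (F n has_real_derivative F (Suc n) x) (at x)"
  shows "smooth_on U (F n)"
proof -
  have "Ck_on j U (F n)" for j
  proof (induction j arbitrary: n)
    case 0
    then show ?case
      using assms(2) by (auto intro!: continuous_at_imp_continuous_on DERIV_isCont)
  next
    case (Suc j)
    show ?case
    proof (rule Ck_on_SucI[OF assms(1)])
      show "(F n has_derivative (\<lambda>v. v * F (Suc n) x)) (at x)" if "x \<in> U" for x
        using assms(2)[OF that, of n]
        by (simp add: has_field_derivative_def mult.commute[of _ "F (Suc n) x"])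
      show "Ck_on j U (\<lambda>x. v * F (Suc n) x)" for v
        by (intro Ck_on_bilinear[OF assms(1) bounded_bilinear_mult] Ck_on_const assms(1) Suc)
    qed
  qed
  then show ?thesis by (simp add: smooth_on_def)
qed

lemma smooth_on_deriv:
  fixes f :: "real \<Rightarrow> real"
  assumes "open U" "smooth_on U f"
  shows "x \<in> U \<Longrightarrow> (f has_real_derivative deriv f x) (at x)"
    and "smooth_on U (deriv f)"
proof -
  have eq: "frechet_derivative f (at x) = (\<lambda>v. deriv f x * v)" if "x \<in> U" for x
  proof -
    have d: "(f has_derivative frechet_derivative f (at x)) (at x)"
      using smooth_on_has_derivative[OF assms(2) that] .
    then have "bounded_linear (frechet_derivative f (at x))"
      by (rule has_derivative_bounded_linear)
    then obtain c where c: "frechet_derivative f (at x) = (\<lambda>v. v * c)"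
      unfolding real_bounded_linear by blast
    have "(f has_real_derivative c) (at x)"
      using d unfolding c has_field_derivative_def by (simp add: mult.commute[of _ c])
    then show ?thesis unfolding c by (simp add: DERIV_imp_deriv mult.commute)
  qed
  then show "x \<in> U \<Longrightarrow> (f has_real_derivative deriv f x) (at x)"
    using smooth_on_has_derivative[OF assms(2)] by (metis has_field_derivative_def)
  show "smooth_on U (deriv f)"
    using smooth_on_frechet_derivative[OF assms(2), of 1] eq
      smooth_on_cong[OF assms(1), of "deriv f" "\<lambda>x. frechet_derivative f (at x) 1"] by simp
qed

lemma smooth_on_iterated_deriv:
  fixes f :: "real \<Rightarrow> real"
  assumes "open U" "smooth_on U f"
  shows "smooth_on U ((deriv ^^ n) f)"
    and "x \<in> U \<Longrightarrow> ((deriv ^^ n) f has_real_derivative (deriv ^^ Suc n) f x) (at x)"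
proof -
  show *: "smooth_on U ((deriv ^^ n) f)" for n
    by (induction n) (use assms smooth_on_deriv in auto)
  show "x \<in> U \<Longrightarrow> ((deriv ^^ n) f has_real_derivative (deriv ^^ Suc n) f x) (at x)"
    using smooth_on_deriv(1)[OF assms(1) *] by simp
qed

lemma
  shows smooth_on_sin: "smooth_on UNIV (sin :: real \<Rightarrow> real)"
    and smooth_on_cos: "smooth_on UNIV (cos :: real \<Rightarrow> real)"
proof -
  have "Ck_on n UNIV (sin :: real \<Rightarrow> real) \<and> Ck_on n UNIV (cos :: real \<Rightarrow> real)" for n
  proof (induction n)
    case 0
    then show ?case by (auto intro: continuous_intros)
  next
    case (Suc n)
    have "Ck_on n UNIV (\<lambda>x::real. v * cos x)" "Ck_on n UNIV (\<lambda>x::real. (- v) * sin x)" for v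
      using Suc by (intro Ck_on_bilinear[OF _ bounded_bilinear_mult] Ck_on_const; simp)+
    then show ?case
      by (intro conjI Ck_on_SucI[where f' = "\<lambda>x v. v * cos x"] Ck_on_SucI[where f' = "\<lambda>x v. (- v) * sin x"])
        (auto intro!: derivative_eq_intros simp: mult.commute)
  qed
  then show "smooth_on UNIV (sin :: real \<Rightarrow> real)" "smooth_on UNIV (cos :: real \<Rightarrow> real)"
    by (auto simp: smooth_on_def)
qed

subsection \<open>Hadamard quotients and Borel's lemma\<close>

text \<open>The quotient is the integral of \<open>p' (u * s)\<close> over \<open>u\<close> in
  \<open>[0, 1]\<close>, by the fundamental theorem of calculus along the segment from 0 to
  \<open>s\<close>. Unlike \<open>p s / s\<close>, the integral is visibly smooth at 0.\<close>

lemma hadamard_quotient: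
  fixes p :: "real \<Rightarrow> real"
  assumes "smooth_on (ball 0 r) p" "p 0 = 0"
  obtains q where "smooth_on (ball 0 r) q" "\<And>s. s \<in> ball 0 r \<Longrightarrow> p s = s * q s"
proof -
  define F where "F n = (deriv ^^ n) p" for n
  have F: "(F n has_real_derivative F (Suc n) x) (at x)" if "x \<in> ball 0 r" for n x
    using smooth_on_iterated_deriv(2)[OF open_ball assms(1) that] by (simp only: F_def)
  have contF: "continuous_on (ball 0 r) (F n)" for n
    using F by (auto intro!: continuous_at_imp_continuous_on DERIV_isCont)
  have scaled: "u * s \<in> ball 0 r" if "s \<in> ball 0 r" "u \<in> {0..1}" for s u :: real
    using that mult_left_le_one_le[of "\<bar>s\<bar>" u] by (auto simp: abs_mult)
  \<comment> \<open>Differentiation under the integral sign: \<open>Q n\<close> is to be the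
    \<open>n\<close>-th derivative of the quotient, each derivative in \<open>s\<close> bringing out
    one more factor \<open>u\<close>.\<close>
  define Q where "Q n s = integral (cbox 0 1) (\<lambda>u. u ^ n * F (Suc n) (u * s))" for n s
  have cont2: "continuous_on (ball 0 r \<times> cbox 0 1) (\<lambda>(s, u). u ^ n * F m (u * s))" for n m
    unfolding split_beta
    by (intro continuous_intros continuous_on_compose2[OF contF]) (use scaled in auto)
  have "(Q n has_real_derivative Q (Suc n) x) (at x)" if x: "x \<in> ball 0 r" for n x
  proof -
    have "(Q n has_real_derivative Q (Suc n) x) (at x within ball 0 r)"
      unfolding Q_def
    proof (rule leibniz_rule_field_derivative)
      fix s u :: real assume su: "s \<in> ball 0 r" "u \<in> cbox 0 1"
      have "((\<lambda>s. F (Suc n) (u * s)) has_real_derivative F (Suc (Suc n)) (u * s) * u) (at s)"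
        using su by (intro DERIV_chain2[where f = "F (Suc n)" and g = "\<lambda>s. u * s", OF F[OF scaled] DERIV_cmult_Id]) auto
      from DERIV_cmult[OF this, of "u ^ n"]
      show "((\<lambda>s. u ^ n * F (Suc n) (u * s)) has_real_derivative
          u ^ Suc n * F (Suc (Suc n)) (u * s)) (at s within ball 0 r)"
        by (rule has_field_derivative_at_within[OF DERIV_cong]) (simp add: algebra_simps)
    next
      fix s :: real assume "s \<in> ball 0 r"
      then show "(\<lambda>u. u ^ n * F (Suc n) (u * s)) integrable_on cbox 0 1"
        by (intro integrable_continuous continuous_intros continuous_on_compose2[OF contF])
          (use scaled in auto)
    qed (use x cont2[of "Suc n" "Suc (Suc n)"] in auto)
    then show ?thesis using x by (simp add: at_within_open[OF _ open_ball])
  qed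
  then have "smooth_on (ball 0 r) (Q 0)"
    by (rule smooth_on_derivative_sequence[OF open_ball])
  moreover have "p s = s * Q 0 s" if s: "s \<in> ball 0 r" for s
  proof -
    have "((\<lambda>u. s * F 1 (u * s)) has_integral F 0 (1 * s) - F 0 (0 * s)) {0..1}"
    proof (rule fundamental_theorem_of_calculus)
      fix u :: real assume u: "u \<in> {0..1}"
      have "((\<lambda>u. F 0 (u * s)) has_real_derivative F 1 (u * s) * s) (at u)"
        using DERIV_chain2[where f = "F 0" and g = "\<lambda>u. u * s", OF F[OF scaled[OF s u]] DERIV_cmult_right[OF DERIV_ident]]
        by simp
      then show "((\<lambda>u. F 0 (u * s)) has_vector_derivative s * F 1 (u * s)) (at u within {0..1})"
        unfolding has_real_derivative_iff_has_vector_derivative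
        by (simp add: mult.commute has_vector_derivative_at_within)
    qed simp
    then have "integral {0..1} (\<lambda>u. s * F 1 (u * s)) = F 0 (1 * s) - F 0 (0 * s)"
      by (rule integral_unique)
    then show ?thesis using assms(2) by (simp add: Q_def F_def)
  qed
  ultimately show ?thesis using that by blast
qed

text \<open>Convergence of \<open>p s / s ^ N\<close> forces \<open>p 0 = 0\<close> when
  \<open>N > 0\<close>, so one factor \<open>s\<close> splits off and the limit passes to the
  quotient. After \<open>N\<close> divisions continuity identifies the value at 0. A limit records
  the order of vanishing and the leading coefficient together.\<close>

lemma hadamard_quotient_power:
  fixes p :: "real \<Rightarrow> real"
  assumes "0 < r" "smooth_on (ball 0 r) p" "((\<lambda>s. p s / s ^ N) \<longlongrightarrow> L) (at 0)"
  shows "\<exists>q. smooth_on (ball 0 r) q \<and> q 0 = L \<and> (\<forall>s \<in> ball 0 r. p s = s ^ N * q s)"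
  using assms(2,3)
proof (induction N arbitrary: p)
  case 0
  have "isCont p 0"
    using smooth_on_continuous[OF 0(1)] \<open>0 < r\<close> by (simp add: continuous_on_eq_continuous_at)
  then have "p 0 = L"
    using 0(2) by (simp add: isCont_def LIM_unique)
  then show ?case using 0(1) by auto
next
  case (Suc N)
  have cont: "isCont p 0"
    using smooth_on_continuous[OF Suc.prems(1)] \<open>0 < r\<close> by (simp add: continuous_on_eq_continuous_at)
  have "((\<lambda>s. p s / s ^ Suc N * s ^ Suc N) \<longlongrightarrow> 0) (at 0)"
    by (rule tendsto_eq_rhs[OF tendsto_mult[OF Suc.prems(2) tendsto_power[OF tendsto_ident_at]]]) simp
  then have "(p \<longlongrightarrow> 0) (at 0)"
    by (rule Lim_transform_eventually) (auto simp: eventually_at_filter)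
  with cont have "p 0 = 0"
    by (meson isCont_def LIM_unique)
  then obtain p1 where p1: "smooth_on (ball 0 r) p1" "\<And>s. s \<in> ball 0 r \<Longrightarrow> p s = s * p1 s"
    using hadamard_quotient[OF Suc.prems(1)] by metis
  have "((\<lambda>s. p1 s / s ^ N) \<longlongrightarrow> L) (at 0)"
  proof (rule Lim_transform_eventually[OF Suc.prems(2)])
    show "\<forall>\<^sub>F s in at 0. p s / s ^ Suc N = p1 s / s ^ N"
      using eventually_at_ball'[OF \<open>0 < r\<close>, of 0 UNIV]
      by eventually_elim (use p1(2) in auto)
  qed
  from Suc.IH[OF p1(1) this] p1(2) show ?case
    by (metis mult.assoc power_Suc)
qed

text \<open>
  The powers of \<open>tanh\<close> serve as building blocks in Borel's lemma: \<open>tanh_deriv n j\<close> is the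
  \<open>n\<close>-th derivative of \<open>tanh\<^sup>j\<close>, because \<open>tanh' = 1 - tanh\<^sup>2\<close>.
\<close>

primrec tanh_deriv :: "nat \<Rightarrow> nat \<Rightarrow> real \<Rightarrow> real" where
  "tanh_deriv 0 j = (\<lambda>x. tanh x ^ j)"
| "tanh_deriv (Suc n) j = (\<lambda>x. real j * (tanh_deriv n (j - 1) x - tanh_deriv n (j + 1) x))"

lemma has_derivative_tanh_deriv:
  "(tanh_deriv n j has_real_derivative tanh_deriv (Suc n) j x) (at x)"
proof (induction n arbitrary: j)
  case 0
  have "((\<lambda>x. tanh x ^ j) has_real_derivative real j * (tanh x ^ (j - 1) * (1 - tanh x ^ 2))) (at x)"
    by (auto intro!: derivative_eq_intros simp: cosh_real_nonzero)
  \<comment> \<open>For \<open>j = 0\<close> the truncated \<open>j - 1\<close> is harmless, because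
    the factor \<open>real j\<close> is 0.\<close>
  also have "real j * (tanh x ^ (j - 1) * (1 - tanh x ^ 2)) = real j * (tanh x ^ (j - 1) - tanh x ^ (j + 1))"
    by (cases j) (auto simp: algebra_simps power2_eq_square)
  finally show ?case by simp
next
  case (Suc n)
  show ?case
    using DERIV_cmult[OF DERIV_diff[OF Suc[of "j - 1"] Suc[of "j + 1"]], of "real j"] by simp
qed

text \<open>\<open>tanh\<close> vanishes at 0 with derivative 1, so \<open>tanh ^ j\<close> behaves
  there like \<open>x ^ j\<close>. This makes the system for the derivatives at 0 triangular, with
  diagonal \<open>fact n\<close>.\<close>

lemma tanh_deriv_at_0:
  shows "n < j \<Longrightarrow> tanh_deriv n j 0 = 0" and "tanh_deriv n n 0 = fact n"
proof -
  show *: "n < j \<Longrightarrow> tanh_deriv n j 0 = 0" for n j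
    by (induction n arbitrary: j) auto
  show "tanh_deriv n n 0 = fact n"
    by (induction n) (use * in auto)
qed

text \<open>Each differentiation yields two terms and a factor equal to the current exponent, which
  never exceeds \<open>j + n\<close>, while \<open>\<bar>tanh x\<bar> \<le> 1\<close>. The bound is
  uniform on the whole line, as it would not be for the monomials \<open>x ^ j\<close>.\<close>

lemma abs_tanh_deriv_le: "\<bar>tanh_deriv n j x\<bar> \<le> (2 * real (j + n)) ^ n"
proof (induction n arbitrary: j)
  case 0
  have "\<bar>tanh x\<bar> \<le> 1"
    using tanh_real_lt_1[of x] tanh_real_gt_neg1[of x] by linarith
  then show ?case by (simp add: power_abs power_le_one)
next
  case (Suc n)
  have "\<bar>tanh_deriv n (j - 1) x - tanh_deriv n (j + 1) x\<bar> \<le>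
      (2 * real (j - 1 + n)) ^ n + (2 * real (j + 1 + n)) ^ n"
    using Suc[of "j - 1"] Suc[of "j + 1"] by linarith
  also have "\<dots> \<le> 2 * (2 * real (j + Suc n)) ^ n"
    using power_mono[of "2 * real (j - 1 + n)" "2 * real (j + Suc n)" n] by simp
  finally have "\<bar>tanh_deriv (Suc n) j x\<bar> \<le> real j * (2 * (2 * real (j + Suc n)) ^ n)"
    by (simp add: abs_mult mult_left_mono)
  also have "\<dots> \<le> real (j + Suc n) * (2 * (2 * real (j + Suc n)) ^ n)"
    by (intro mult_right_mono) auto
  finally show ?case by (simp add: algebra_simps)
qed

text \<open>A dilation factor large enough for convergence: \<open>(4 * real j) ^ j\<close> bounds
  \<open>tanh_deriv n j\<close> for all \<open>n < j\<close>, \<open>2 ^ j\<close> leaves room for a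
  geometric series, and the summand 1 keeps the factor at least 1, also for
  \<open>d = 0\<close>.\<close>

definition borel_scale :: "real \<Rightarrow> nat \<Rightarrow> real" where
  "borel_scale d j = 1 + 2 ^ j * \<bar>d\<bar> * (4 * real j) ^ j"

text \<open>The \<open>n\<close>-th derivative of \<open>d * (tanh (b * x) / b) ^ j\<close> with
  \<open>b = borel_scale d j\<close>. Its \<open>j\<close>-th derivative at 0 is
  \<open>d * fact j\<close> whatever \<open>b\<close> is, so \<open>b\<close> can be enlarged
  without changing the leading coefficient.\<close>

definition borel_term :: "real \<Rightarrow> nat \<Rightarrow> nat \<Rightarrow> real \<Rightarrow> real" where
  "borel_term d n j x =
    d * borel_scale d j ^ n / borel_scale d j ^ j * tanh_deriv n j (borel_scale d j * x)"

lemma borel_scale_ge_1: "1 \<le> borel_scale d j"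
  by (simp add: borel_scale_def)

lemma has_derivative_borel_term:
  "(borel_term d n j has_real_derivative borel_term d (Suc n) j x) (at x)"
proof -
  let ?b = "borel_scale d j"
  have "((\<lambda>x. tanh_deriv n j (?b * x)) has_real_derivative tanh_deriv (Suc n) j (?b * x) * ?b) (at x)"
    by (rule DERIV_chain2[OF has_derivative_tanh_deriv]) (auto intro!: derivative_eq_intros)
  from DERIV_cmult[OF this, of "d * ?b ^ n / ?b ^ j"] show ?thesis
    by (simp add: borel_term_def[abs_def] mult_ac)
qed

lemma abs_borel_term_le:
  assumes "n < j"
  shows "\<bar>borel_term d n j x\<bar> \<le> (1 / 2) ^ j"
proof -
  let ?b = "borel_scale d j" and ?K = "(4 * real j) ^ j"
  have b: "1 \<le> ?b" by (rule borel_scale_ge_1)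
  have "(2 * real (j + n)) ^ n \<le> (4 * real j) ^ n"
    using assms by (intro power_mono) auto
  also have "\<dots> \<le> ?K"
    using assms by (intro power_increasing) auto
  finally have W: "\<bar>tanh_deriv n j (?b * x)\<bar> \<le> ?K"
    using abs_tanh_deriv_le[of n j "?b * x"] by linarith
  have "?b * ?b ^ n \<le> ?b ^ j"
    using power_increasing[of "Suc n" j ?b] assms b by simp
  then have "?b ^ n / ?b ^ j \<le> 1 / ?b"
    using b by (simp add: field_simps)
  then have "\<bar>d\<bar> * (?b ^ n / ?b ^ j) * \<bar>tanh_deriv n j (?b * x)\<bar> \<le> \<bar>d\<bar> * (1 / ?b) * ?K"
    using b W by (intro mult_mono) auto
  also have "\<dots> \<le> (1 / 2) ^ j"
    using b by (simp add: field_simps) (simp add: borel_scale_def)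
  finally show ?thesis
    using b by (simp add: borel_term_def abs_mult)
qed

text \<open>The coefficients solve the triangular system saying that the derivatives at \<open>0\<close> are \<open>t\<close>.\<close>

fun borel_coeff :: "(nat \<Rightarrow> real) \<Rightarrow> nat \<Rightarrow> real" where
  "borel_coeff t n = (t n - (\<Sum>j<n. borel_term (borel_coeff t j) n j 0)) / fact n"

declare borel_coeff.simps [simp del]

text \<open>For each \<open>n\<close> all but finitely many terms of the \<open>n\<close> times
  differentiated series are dominated by a geometric series, so termwise differentiation is allowed
  to any order. The whole chain of derivatives is returned because Whitney's theorem pastes each
  derivative separately.\<close>

lemma borel_lemma:
  fixes t :: "nat \<Rightarrow> real"
  obtains F :: "nat \<Rightarrow> real \<Rightarrow> real"
  where "\<And>n x. (F n has_real_derivative F (Suc n) x) (at x)" "\<And>n. F n 0 = t n"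
proof -
  define u where "u n j x = borel_term (borel_coeff t j) n j x" for n j x
  have bound: "\<forall>\<^sub>F j in sequentially. \<forall>x\<in>UNIV. norm (u n j x) \<le> (1 / 2) ^ j" for n
    using eventually_gt_at_top[of n] by eventually_elim (auto simp: u_def abs_borel_term_le)
  have summable: "summable (\<lambda>j. u n j x)" for n x
    by (rule summable_comparison_test_ev[OF _ summable_geometric[of "1 / 2 :: real"]])
      (use bound[of n] in \<open>auto elim: eventually_mono\<close>)
  define F where "F n x = (\<Sum>j. u n j x)" for n x
  have "(F n has_real_derivative F (Suc n) x) (at x)" for n x
    unfolding F_def
  proof (rule has_field_derivative_series'(2))
    show "(u n j has_real_derivative u (Suc n) j x) (at x within UNIV)" for j x
      using has_derivative_borel_term by (simp add: u_def[abs_def])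
    show "uniformly_convergent_on UNIV (\<lambda>m x. \<Sum>j<m. u (Suc n) j x)"
      by (rule Weierstrass_m_test'_ev[OF bound]) (simp add: summable_geometric)
  qed (use summable in auto)
  moreover have "F n 0 = t n" for n
  proof -
    have "F n 0 = (\<Sum>j\<le>n. u n j 0)"
      unfolding F_def
      by (rule suminf_finite) (auto simp: u_def borel_term_def tanh_deriv_at_0)
    also have "\<dots> = (\<Sum>j<n. u n j 0) + u n n 0"
      by (simp flip: lessThan_Suc_atMost)
    also have "u n n 0 = borel_coeff t n * fact n"
      using borel_scale_ge_1[of "borel_coeff t n" n] by (simp add: u_def borel_term_def tanh_deriv_at_0)
    also have "\<dots> = t n - (\<Sum>j<n. u n j 0)"
      by (subst borel_coeff.simps) (simp add: u_def)
    finally show ?thesis by simp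
  qed
  ultimately show ?thesis using that by blast
qed

subsection \<open>Even functions\<close>

text \<open>If \<open>h s = g (s ^ 2)\<close>, then \<open>q s = g' (s ^ 2)\<close>: dividing by
  \<open>2 * s\<close> differentiates with respect to \<open>s ^ 2\<close>. The derivative of an
  even function is odd, hence 0 at 0, so the division is smooth; its result is even again and the
  step can be repeated.\<close>

lemma smooth_even_deriv:
  fixes h :: "real \<Rightarrow> real"
  assumes "smooth_on (ball 0 r) h" "\<And>s. s \<in> ball 0 r \<Longrightarrow> h (- s) = h s"
  obtains q where "smooth_on (ball 0 r) q" "\<And>s. s \<in> ball 0 r \<Longrightarrow> q (- s) = q s"
    "\<And>s. s \<in> ball 0 r \<Longrightarrow> (h has_real_derivative 2 * s * q s) (at s)"
proof -
  note d = smooth_on_deriv[OF open_ball assms(1)]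
  have odd: "deriv h (- s) = - deriv h s" if s: "s \<in> ball 0 r" for s
  proof -
    have "((\<lambda>x. h (- x)) has_real_derivative deriv h (- s) * (- 1)) (at s)"
      by (rule DERIV_chain2[where f = h and g = uminus, OF d(1)])
        (use s in \<open>auto intro!: derivative_eq_intros\<close>)
    then have "((\<lambda>x. h (- x)) has_real_derivative - deriv h (- s)) (at s)" by simp
    then have "(h has_real_derivative - deriv h (- s)) (at s)"
      using has_field_derivative_transform_within_open[OF _ open_ball s] assms(2) by blast
    then show ?thesis using d(1)[OF s] DERIV_unique by fastforce
  qed
  show ?thesis
  proof (cases "r > 0")
    case True
    then have "deriv h 0 = 0" using odd[of 0] by simp
    then obtain p where p: "smooth_on (ball 0 r) p" "\<And>s. s \<in> ball 0 r \<Longrightarrow> deriv h s = s * p s"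
      using hadamard_quotient[OF d(2)] by metis
    show ?thesis
    proof
      show "smooth_on (ball 0 r) (\<lambda>s. p s * (1 / 2))"
        using p(1) by (intro smooth_on_intros) auto
      show "p (- s) * (1 / 2) = p s * (1 / 2)" if "s \<in> ball 0 r" for s
        using odd[OF that] p(2)[OF that] p(2)[of "- s"] that by (cases "s = 0") auto
      show "(h has_real_derivative 2 * s * (p s * (1 / 2))) (at s)" if "s \<in> ball 0 r" for s
        using d(1)[OF that] p(2)[OF that] by simp
    qed
  next
    case False
    then show ?thesis using that[of h] assms by simp
  qed
qed

text \<open>
  Whitney's theorem on even functions. The candidate \<open>g X = f (sqrt X)\<close> is smooth up to \<open>X = 0\<close>
  from the right; Borel's lemma continues it smoothly to negative \<open>X\<close>.
\<close>

lemma whitney_even: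
  fixes f :: "real \<Rightarrow> real"
  assumes "0 < r" "smooth_on (ball 0 r) f" "\<And>s. s \<in> ball 0 r \<Longrightarrow> f (- s) = f s"
  obtains g where "smooth_on (ball 0 (r ^ 2)) g" "\<And>s. s \<in> ball 0 r \<Longrightarrow> f s = g (s ^ 2)"
proof -
  define P where "P h \<longleftrightarrow> smooth_on (ball 0 r) h \<and> (\<forall>s \<in> ball 0 r. h (- s) = h s)" for h :: "real \<Rightarrow> real"
  \<comment> \<open>\<open>H n s\<close> plays the part of the \<open>n\<close>-th derivative of
    \<open>g\<close> at \<open>s ^ 2\<close>; the sequence arises by iterating the division step,
    hence dependent choice.\<close>
  have "\<exists>H. \<forall>n. (P (H n) \<and> (n = 0 \<longrightarrow> H n = f)) \<and>
      (\<forall>s \<in> ball 0 r. (H n has_real_derivative 2 * s * H (Suc n) s) (at s))"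
  proof (rule dependent_nat_choice)
    show "\<exists>h. P h \<and> (0 = (0::nat) \<longrightarrow> h = f)"
      using assms by (auto simp: P_def)
    fix h and n :: nat
    assume "P h \<and> (n = 0 \<longrightarrow> h = f)"
    then show "\<exists>q. (P q \<and> (Suc n = 0 \<longrightarrow> q = f)) \<and>
        (\<forall>s \<in> ball 0 r. (h has_real_derivative 2 * s * q s) (at s))"
      using smooth_even_deriv[of r h] unfolding P_def by (metis nat.distinct(1))
  qed
  then obtain H where H: "H 0 = f" "\<And>n. P (H n)"
    "\<And>n s. s \<in> ball 0 r \<Longrightarrow> (H n has_real_derivative 2 * s * H (Suc n) s) (at s)"
    by blast
  \<comment> \<open>The values \<open>H n 0\<close> are the right-hand derivatives of
    \<open>g\<close> at 0; the left branch is given the same ones, so that all derivatives match at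
    the seam.\<close>
  obtain \<beta> where \<beta>: "\<And>n x. (\<beta> n has_real_derivative \<beta> (Suc n) x) (at x)" "\<And>n. \<beta> n 0 = H n 0"
    using borel_lemma[of "\<lambda>n. H n 0"] by metis
  define G where "G n X = (if 0 < X then H n (sqrt X) else \<beta> n X)" for n X
  have "(G n has_real_derivative G (Suc n) X) (at X)" if X: "X \<in> ball 0 (r ^ 2)" for n X
  proof -
    consider "X > 0" | "X < 0" | "X = 0" by linarith
    then show ?thesis
    proof cases
      case 1
      have "sqrt X < r"
        using X 1 \<open>0 < r\<close> real_sqrt_less_iff[of X "r ^ 2"] by simp
      then have "(H n has_real_derivative 2 * sqrt X * H (Suc n) (sqrt X)) (at (sqrt X))"
        using 1 by (intro H(3)) simp
      from DERIV_chain2[OF this DERIV_real_sqrt[OF 1]]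
      have "((\<lambda>X. H n (sqrt X)) has_real_derivative G (Suc n) X) (at X)"
        using 1 by (simp add: G_def field_simps)
      then show ?thesis
        by (rule has_field_derivative_transform_within_open[of _ _ _ "{0<..}"])
          (use 1 in \<open>auto simp: G_def\<close>)
    next
      case 2
      then have "(\<beta> n has_real_derivative G (Suc n) X) (at X)"
        using \<beta>(1) by (simp add: G_def)
      then show ?thesis
        by (rule has_field_derivative_transform_within_open[of _ _ _ "{..<0}"])
          (use 2 in \<open>auto simp: G_def\<close>)
    next
      case 3
      \<comment> \<open>Under \<open>s = sqrt X\<close> this becomes the right-hand difference
        quotient of \<open>G n\<close> at 0; L'Hopital's rule cancels the factor
        \<open>2 * s\<close>.\<close>
      have "((\<lambda>s. (H n s - H n 0) / s ^ 2) \<longlongrightarrow> H (Suc n) 0) (at 0)"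
      proof (rule lhopital)
        have cont: "isCont (H m) 0" for m
          using H(3)[of 0 m] \<open>0 < r\<close> by (auto intro: DERIV_isCont)
        then have "(H n \<longlongrightarrow> H n 0) (at 0)" by (simp add: isCont_def)
        then show "((\<lambda>s. H n s - H n 0) \<longlongrightarrow> 0) (at 0)"
          by (simp add: LIM_zero)
        show "((\<lambda>s::real. s ^ 2) \<longlongrightarrow> 0) (at 0)"
          by (auto intro!: tendsto_eq_intros)
        show "\<forall>\<^sub>F s::real in at 0. s ^ 2 \<noteq> 0" "\<forall>\<^sub>F s::real in at 0. 2 * s \<noteq> 0"
          by (auto simp: eventually_at_filter)
        show "\<forall>\<^sub>F s in at 0. ((\<lambda>s. H n s - H n 0) has_real_derivative 2 * s * H (Suc n) s) (at s)"
          using eventually_at_ball[OF \<open>0 < r\<close>, of 0 UNIV]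
          by eventually_elim (use H(3) in \<open>auto intro!: derivative_eq_intros\<close>)
        show "\<forall>\<^sub>F s::real in at 0. ((\<lambda>s. s ^ 2) has_real_derivative 2 * s) (at s)"
          by (auto intro!: always_eventually derivative_eq_intros)
        have "(H (Suc n) \<longlongrightarrow> H (Suc n) 0) (at 0)"
          using cont by (simp add: isCont_def)
        then show "((\<lambda>s. 2 * s * H (Suc n) s / (2 * s)) \<longlongrightarrow> H (Suc n) 0) (at 0)"
          by (rule Lim_transform_eventually) (auto simp: eventually_at_filter)
      qed
      then have "((\<lambda>X. (H n (sqrt X) - H n 0) / sqrt X ^ 2) \<longlongrightarrow> H (Suc n) 0) (at_right 0)"
        by (rule filterlim_compose)
          (auto simp: filterlim_at eventually_at_filter intro!: tendsto_eq_intros)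
      then have right: "((\<lambda>X. (G n X - G n 0) / (X - 0)) \<longlongrightarrow> H (Suc n) 0) (at_right 0)"
        by (rule Lim_transform_eventually) (auto simp: eventually_at_filter G_def \<beta>(2))
      have "((\<lambda>X. (\<beta> n X - \<beta> n 0) / (X - 0)) \<longlongrightarrow> \<beta> (Suc n) 0) (at_left 0)"
        using \<beta>(1)[of n 0] unfolding has_field_derivative_iff
        by (rule filterlim_mono) (auto simp: at_le)
      then have "((\<lambda>X. (G n X - G n 0) / (X - 0)) \<longlongrightarrow> H (Suc n) 0) (at_left 0)"
        unfolding \<beta>(2) by (rule Lim_transform_eventually) (auto simp: eventually_at_filter G_def \<beta>(2))
      with right show ?thesis
        unfolding 3 has_field_derivative_iff
        by (simp add: filterlim_split_at G_def \<beta>(2))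
    qed
  qed
  then have "smooth_on (ball 0 (r ^ 2)) (G 0)"
    by (rule smooth_on_derivative_sequence[OF open_ball])
  moreover have "f s = G 0 (s ^ 2)" if "s \<in> ball 0 r" for s
    using H(1) \<beta>(2)[of 0] assms(3)[OF that] by (cases s "0::real" rule: linorder_cases) (auto simp: G_def)
  ultimately show ?thesis using that by blast
qed

text \<open>Whitney's theorem applies to the even part directly. The limit makes the odd part
  divisible by \<open>s ^ N\<close>, and since \<open>N\<close> is odd the quotient is even, so
  Whitney's theorem applies once more; the value of the quotient at 0 is \<open>L\<close>.\<close>

lemma even_odd_decomposition:
  fixes f :: "real \<Rightarrow> real"
  assumes "0 < r" "smooth_on (ball 0 r) f" "odd N"
    and L: "((\<lambda>s. (f s - f (- s)) / 2 / s ^ N) \<longlongrightarrow> L) (at 0)"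
  obtains A B where "smooth_on (ball 0 (r ^ 2)) A" "smooth_on (ball 0 (r ^ 2)) B" "B 0 = L"
    "\<And>s. s \<in> ball 0 r \<Longrightarrow> f s = A (s ^ 2) + s ^ N * B (s ^ 2)"
proof -
  let ?D = "ball (0::real) r"
  have refl: "smooth_on ?D (\<lambda>s. f (- s))"
    by (rule smooth_on_compose[OF open_ball open_ball assms(2) smooth_on_minus[OF _ smooth_on_ident]]) auto
  have "smooth_on ?D (\<lambda>s. (1 / 2) * (f s + f (- s)))"
    by (intro smooth_on_intros refl assms(2) open_ball)
  then obtain A where A: "smooth_on (ball 0 (r ^ 2)) A"
    "\<And>s. s \<in> ?D \<Longrightarrow> (1 / 2) * (f s + f (- s)) = A (s ^ 2)"
    by (rule whitney_even[OF \<open>0 < r\<close>]) (auto simp: add.commute)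
  have "smooth_on ?D (\<lambda>s. (1 / 2) * (f s - f (- s)))"
    by (intro smooth_on_intros refl assms(2) open_ball)
  moreover have "((\<lambda>s. (1 / 2) * (f s - f (- s)) / s ^ N) \<longlongrightarrow> L) (at 0)"
    using L by simp
  ultimately obtain q where q: "smooth_on ?D q" "q 0 = L"
    "\<And>s. s \<in> ?D \<Longrightarrow> (1 / 2) * (f s - f (- s)) = s ^ N * q s"
    using hadamard_quotient_power[OF \<open>0 < r\<close>] by blast
  have "q (- s) = q s" if "s \<in> ?D" for s
  proof (cases "s = 0")
    case False
    have "s ^ N * q (- s) = - ((1 / 2) * (f (- s) - f s))"
      using q(3)[of "- s"] that \<open>odd N\<close> by simp
    also have "\<dots> = (1 / 2) * (f s - f (- s))" by (simp add: field_simps)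
    also have "\<dots> = s ^ N * q s" by (rule q(3)[OF that])
    finally have "s ^ N * q (- s) = s ^ N * q s" .
    then show ?thesis using False by simp
  qed simp
  then obtain B where B: "smooth_on (ball 0 (r ^ 2)) B" "\<And>s. s \<in> ?D \<Longrightarrow> q s = B (s ^ 2)"
    using whitney_even[OF \<open>0 < r\<close> q(1)] by metis
  have "f s = A (s ^ 2) + s ^ N * B (s ^ 2)" if "s \<in> ?D" for s
    using A(2)[OF that] q(3)[OF that] B(2)[OF that] by (simp add: field_simps)
  moreover have "B 0 = L"
    using B(2)[of 0] q(2) \<open>0 < r\<close> by simp
  ultimately show ?thesis using that A(1) B(1) by blast
qed

subsection \<open>The inverse function theorem and strict differentiability\<close>

text \<open>The inverse function theorem and the strict derivative estimate rest on a derivative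
  that is continuous in operator norm. In finite dimension continuity along basis directions
  suffices for that.\<close>

lemma smooth_on_blinfun_derivative:
  fixes f :: "'a::euclidean_space \<Rightarrow> 'b::euclidean_space"
  assumes "smooth_on U f"
  obtains f' where "\<And>x. x \<in> U \<Longrightarrow> (f has_derivative blinfun_apply (f' x)) (at x)" "continuous_on U f'"
proof
  let ?f' = "\<lambda>x. Blinfun (frechet_derivative f (at x))"
  have eq: "blinfun_apply (?f' x) = frechet_derivative f (at x)" if "x \<in> U" for x
    using smooth_on_has_derivative[OF assms that]
    by (intro bounded_linear_Blinfun_apply has_derivative_bounded_linear)
  then show "(f has_derivative blinfun_apply (?f' x)) (at x)" if "x \<in> U" for x
    using smooth_on_has_derivative[OF assms that] that by simp
  show "continuous_on U ?f'"
  proof (rule continuous_on_blinfun_componentwise)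
    fix i :: 'a
    have "continuous_on U (\<lambda>x. frechet_derivative f (at x) i)"
      using smooth_on_continuous[OF smooth_on_frechet_derivative[OF assms]] .
    then show "continuous_on U (\<lambda>x. blinfun_apply (?f' x) i)"
      by (rule continuous_on_eq) (simp add: eq)
  qed
qed

text \<open>The mean value inequality for \<open>f - D\<close>, whose derivative near
  \<open>x0\<close> has norm at most \<open>e\<close>. Both points move, because the estimate will
  compare values belonging to \<open>t\<close> and to \<open>- t\<close>.\<close>

lemma smooth_on_strict_derivative:
  fixes f :: "'a::euclidean_space \<Rightarrow> 'b::euclidean_space"
  assumes "open U" "x0 \<in> U" "smooth_on U f" "(f has_derivative D) (at x0)" "0 < e"
  shows "\<exists>d>0. \<forall>x\<in>ball x0 d. \<forall>y\<in>ball x0 d. norm (f x - f y - D (x - y)) \<le> e * norm (x - y)"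
proof -
  obtain f' where f': "\<And>x. x \<in> U \<Longrightarrow> (f has_derivative blinfun_apply (f' x)) (at x)" "continuous_on U f'"
    using smooth_on_blinfun_derivative[OF assms(3)] by blast
  have D: "D = blinfun_apply (f' x0)"
    using has_derivative_unique[OF assms(4) f'(1)[OF assms(2)]] .
  have "isCont f' x0"
    using f'(2) assms(1,2) by (simp add: continuous_on_eq_continuous_at)
  then obtain d1 where d1: "d1 > 0" "\<And>x. dist x x0 < d1 \<Longrightarrow> dist (f' x) (f' x0) < e"
    using \<open>0 < e\<close> unfolding continuous_at_eps_delta by blast
  obtain d2 where d2: "d2 > 0" "ball x0 d2 \<subseteq> U"
    using assms(1,2) open_contains_ball by blast
  define d where "d = min d1 d2"
  have "norm (f x - f y - D (x - y)) \<le> e * norm (x - y)"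
    if xy: "x \<in> ball x0 d" "y \<in> ball x0 d" for x y
  proof -
    have "norm ((f x - D x) - (f y - D y)) \<le> e * norm (x - y)"
    proof (rule differentiable_bound[OF convex_ball _ _ xy])
      fix z assume z: "z \<in> ball x0 d"
      then have "z \<in> U" using d2 by (auto simp: d_def)
      then show "((\<lambda>x. f x - D x) has_derivative blinfun_apply (f' z - f' x0)) (at z within ball x0 d)"
        unfolding D blinfun.diff_left
        by (intro has_derivative_diff has_derivative_at_withinI[OF f'(1)]
            bounded_linear_imp_has_derivative blinfun.bounded_linear_right)
      show "onorm (blinfun_apply (f' z - f' x0)) \<le> e"
        using less_imp_le[OF d1(2)[of z]] z
        by (simp add: d_def dist_norm norm_blinfun.rep_eq norm_minus_commute[of x0])
    qed
    moreover have "f x - f y - D (x - y) = (f x - D x) - (f y - D y)"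
      by (simp add: D blinfun.diff_right)
    ultimately show ?thesis by (simp only:)
  qed
  moreover have "d > 0" using d1 d2 by (simp add: d_def)
  ultimately show ?thesis by blast
qed

text \<open>The inverse function theorem supplies a differentiable inverse \<open>g\<close> whose
  derivative is the inverse of that of \<open>f\<close> at \<open>g y\<close>. Smoothness follows by
  bootstrapping: by Cramer's rule \<open>g'\<close> is a rational expression in the partial
  derivatives of \<open>f\<close> at \<open>g y\<close>, so if \<open>g\<close> is of class
  \<open>C^n\<close>, then so is \<open>g'\<close>. The explicit 2 by 2 formula ties the statement
  to the plane.\<close>

lemma smooth_inverse_function_R2:
  fixes f :: "real \<times> real \<Rightarrow> real \<times> real"
  assumes "open U" "0 \<in> U" "smooth_on U f" "f 0 = 0"
    and D: "(f has_derivative D) (at 0)" "inj D"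
  shows "diffeo_germ f"
proof -
  obtain f' where f': "\<And>x. x \<in> U \<Longrightarrow> (f has_derivative blinfun_apply (f' x)) (at x)" "continuous_on U f'"
    using smooth_on_blinfun_derivative[OF assms(3)] by blast
  have D_eq: "D = blinfun_apply (f' 0)"
    using has_derivative_unique[OF D(1) f'(1)[OF assms(2)]] .
  have linD: "linear D" using D(1) has_derivative_linear by blast
  obtain E where E: "linear E" "E \<circ> D = id"
    using linear_injective_left_inverse[OF linD D(2)] by blast
  have "Blinfun E o\<^sub>L f' 0 = id_blinfun"
  proof (rule blinfun_eqI)
    fix i
    have "E (D i) = i" using E(2) by (metis comp_apply id_apply)
    then show "blinfun_apply (Blinfun E o\<^sub>L f' 0) i = blinfun_apply id_blinfun i"
      using E(1) by (simp add: bounded_linear_Blinfun_apply linear_linear D_eq)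
  qed
  from inverse_function_theorem[OF assms(1) f' assms(2) this]
  obtain U' V g g' where g: "open U'" "U' \<subseteq> U" "0 \<in> U'" "open V" "homeomorphism U' V f g"
    "\<And>y. y \<in> V \<Longrightarrow> (g has_derivative (g' y)) (at y)"
    "\<And>y. y \<in> V \<Longrightarrow> g' y = inv (blinfun_apply (f' (g y)))"
    "\<And>y. y \<in> V \<Longrightarrow> bij (blinfun_apply (f' (g y)))"
    by metis
  have gV: "g ` V \<subseteq> U"
    using g(2,5) by (auto simp: homeomorphism_def)
  \<comment> \<open>Columns of the Jacobian matrix of \<open>f\<close> at \<open>g y\<close>;
    \<open>dt\<close> is its determinant.\<close>
  define a where "a y = frechet_derivative f (at (g y)) (1, 0)" for y
  define b where "b y = frechet_derivative f (at (g y)) (0, 1)" for y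
  define dt where "dt y = fst (a y) * snd (b y) - snd (a y) * fst (b y)" for y
  have D_g: "blinfun_apply (f' (g y)) v = fst v *\<^sub>R a y + snd v *\<^sub>R b y" if "y \<in> V" for y v
  proof -
    have "blinfun_apply (f' (g y)) = frechet_derivative f (at (g y))"
      using f'(1) gV that frechet_derivative_at by blast
    moreover have "v = fst v *\<^sub>R (1, 0) + snd v *\<^sub>R (0, 1)"
      by (cases v) simp
    ultimately show ?thesis
      unfolding a_def b_def by (metis blinfun.add_right blinfun.scaleR_right)
  qed
  have dt: "dt y \<noteq> 0" if y: "y \<in> V" for y
  proof
    assume 0: "dt y = 0"
    have inj: "inj (blinfun_apply (f' (g y)))" using g(8)[OF y] by (rule bij_is_inj)
    \<comment> \<open>If the determinant is 0, the columns of the adjugate matrix lie in the kernel.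
      Injectivity makes them zero, so \<open>a y = 0\<close>, and then \<open>(1, 0)\<close> lies in
      the kernel.\<close>
    have "blinfun_apply (f' (g y)) (snd (b y), - snd (a y)) = blinfun_apply (f' (g y)) 0"
      "blinfun_apply (f' (g y)) (- fst (b y), fst (a y)) = blinfun_apply (f' (g y)) 0"
      using 0 by (auto simp: D_g[OF y] dt_def prod_eq_iff algebra_simps)
    from this[THEN injD[OF inj]] have "a y = 0"
      by (simp add: prod_eq_iff)
    then have "blinfun_apply (f' (g y)) (1, 0) = blinfun_apply (f' (g y)) 0"
      by (simp add: D_g[OF y])
    from injD[OF inj this] show False by (simp add: prod_eq_iff)
  qed
  have g'_eq: "g' y v = inverse (dt y) *\<^sub>R
      (fst v * snd (b y) - snd v * fst (b y), snd v * fst (a y) - fst v * snd (a y))"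
    if y: "y \<in> V" for y v
  proof -
    let ?p = "fst v * snd (b y) - snd v * fst (b y)" and ?q = "snd v * fst (a y) - fst v * snd (a y)"
    have "?p * fst (a y) + ?q * fst (b y) = dt y * fst v" "?p * snd (a y) + ?q * snd (b y) = dt y * snd v"
      by (simp_all add: dt_def algebra_simps)
    then have "?p *\<^sub>R a y + ?q *\<^sub>R b y = dt y *\<^sub>R v"
      by (simp add: prod_eq_iff)
    then have "blinfun_apply (f' (g y)) (inverse (dt y) *\<^sub>R (?p, ?q)) = v"
      using dt[OF y] unfolding blinfun.scaleR_right by (simp add: D_g[OF y])
    then show ?thesis
      unfolding g(7)[OF y] using inv_f_eq[OF bij_is_inj[OF g(8)[OF y]]] by blast
  qed
  have "Ck_on n V g" for n
  proof (induction n)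
    case 0
    then show ?case using g(5) by (simp add: homeomorphism_def)
  next
    case (Suc n)
    have "Ck_on n V (\<lambda>y. frechet_derivative f (at (g y)) w)" for w
      using smooth_on_frechet_derivative[OF assms(3), of w]
      by (intro Ck_on_compose[OF g(4) assms(1) _ Suc gV, of "\<lambda>x. frechet_derivative f (at x) w"])
        (simp add: smooth_on_def)
    then have ab: "Ck_on n V a" "Ck_on n V b"
      by (simp_all add: a_def[abs_def] b_def[abs_def])
    have fs: "Ck_on n V (\<lambda>y. fst (h y))" "Ck_on n V (\<lambda>y. snd (h y))"
      if "Ck_on n V h" for h :: "real \<times> real \<Rightarrow> real \<times> real"
      using Ck_on_compose[OF g(4) open_UNIV Ck_on_linear[OF open_UNIV bounded_linear_fst] that]
        Ck_on_compose[OF g(4) open_UNIV Ck_on_linear[OF open_UNIV bounded_linear_snd] that] by auto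
    note mult = Ck_on_bilinear[OF g(4) bounded_bilinear_mult]
    have sub: "Ck_on n V (\<lambda>y. p y - q y)" if "Ck_on n V p" "Ck_on n V q" for p q :: "real \<times> real \<Rightarrow> real"
      using Ck_on_add[OF g(4) that(1) mult[OF Ck_on_const[OF g(4), of n "- 1"] that(2)]] by simp
    have "Ck_on n V dt"
      unfolding dt_def[abs_def] by (intro sub mult fs ab)
    then have "Ck_on n V (\<lambda>y. inverse (dt y))"
      by (intro Ck_on_inverse[OF g(4)] dt)
    then have "Ck_on n V (\<lambda>y. inverse (dt y) *\<^sub>R
      (fst v * snd (b y) - snd v * fst (b y), snd v * fst (a y) - fst v * snd (a y)))" for v
      by (intro Ck_on_bilinear[OF g(4) bounded_bilinear_scaleR] Ck_on_Pair[OF g(4)] sub mult fs ab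
          Ck_on_const[OF g(4)])
    then have "Ck_on n V (\<lambda>y. g' y v)" for v
      using Ck_on_cong[OF g(4), of "\<lambda>y. g' y v"] g'_eq by (metis (no_types, lifting))
    then show ?case
      by (intro Ck_on_SucI[OF g(4) g(6)])
  qed
  then have "smooth_on V g" by (simp add: smooth_on_def)
  moreover have "smooth_on U' f" using smooth_on_subset[OF assms(3) g(2)] .
  ultimately show ?thesis
    unfolding diffeo_germ_def using assms(4) g(1,3,4,5) by blast
qed

lemma diffeo_germ_derivative_inj:
  assumes "diffeo_germ h"
  obtains U D where "open U" "0 \<in> U" "smooth_on U h" "(h has_derivative D) (at 0)" "inj D"
proof -
  obtain U V g where U: "open U" "0 \<in> U" "open V" "homeomorphism U V h g" "smooth_on U h" "smooth_on V g"
    using assms unfolding diffeo_germ_def by blast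
  have h: "(h has_derivative frechet_derivative h (at 0)) (at 0)"
    using smooth_on_has_derivative[OF U(5,2)] .
  have "h 0 \<in> V" using U(2,4) by (auto simp: homeomorphism_def)
  then have g: "(g has_derivative frechet_derivative g (at (h 0))) (at (h 0))"
    using smooth_on_has_derivative[OF U(6)] by blast
  have "((\<lambda>x. g (h x)) has_derivative (\<lambda>x. frechet_derivative g (at (h 0)) (frechet_derivative h (at 0) x))) (at 0)"
    using has_derivative_compose[OF h g] .
  moreover have "((\<lambda>x. g (h x)) has_derivative (\<lambda>x. x)) (at 0)"
    using has_derivative_transform_within_open[OF has_derivative_ident U(1,2)] U(4)
    by (metis homeomorphism_def)
  ultimately have "(\<lambda>x. frechet_derivative g (at (h 0)) (frechet_derivative h (at 0) x)) = (\<lambda>x. x)"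
    by (rule has_derivative_unique)
  then have "inj (frechet_derivative h (at 0))"
    by (metis injI)
  then show ?thesis using that U h by blast
qed

subsection \<open>Normal form of \<open>phi2\<close>\<close>

lemma has_vector_derivative_interval_integral:
  fixes f :: "real \<Rightarrow> 'a::euclidean_space"
  assumes "continuous_on (ball 0 r) f" "s \<in> ball 0 r"
  shows "((\<lambda>s. LBINT u=0..s. f u) has_vector_derivative f s) (at s)"
proof -
  define c where "c = (\<bar>s\<bar> + r) / 2"
  have c: "\<bar>s\<bar> < c" "c < r" using assms(2) by (auto simp: c_def)
  have "{- c..c} \<subseteq> ball 0 r" using c by auto
  then have "continuous_on {- c..c} f" using assms(1) continuous_on_subset by blast
  then have "((\<lambda>s. LBINT u=ereal 0..s. f u) has_vector_derivative f s) (at s within {- c..c})"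
    using c by (intro interval_integral_FTC2) auto
  moreover have "at s within {- c..c} = at s"
    using c by (intro at_within_interior) (auto simp: interior_atLeastAtMost_real)
  ultimately show ?thesis by (simp add: zero_ereal_def)
qed

section \<open>Smoothness and first derivatives of \<open>theta\<close> and
  \<open>phi2\<close>\<close>

lemma theta_at_0: "theta \<kappa> 0 = 0"
  and phi2_at_0: "phi2 \<kappa> 0 = 0"
  by (simp_all add: theta_def phi2_def flip: zero_ereal_def)

lemma smooth_theta:
  assumes "smooth_on (ball 0 r) \<kappa>"
  shows "smooth_on (ball 0 r) (theta \<kappa>)"
proof (rule smooth_on_vector_antiderivative[OF open_ball _ assms])
  show "(theta \<kappa> has_vector_derivative \<kappa> s) (at s)" if "s \<in> ball 0 r" for s
    using has_vector_derivative_interval_integral[OF smooth_on_continuous[OF assms] that]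
    by (simp add: theta_def[abs_def])
qed

lemma
  assumes "smooth_on (ball 0 r) \<kappa>"
  shows has_derivative_phi2: "s \<in> ball 0 r \<Longrightarrow>
      (phi2 \<kappa> has_vector_derivative s *\<^sub>R (cos (theta \<kappa> s), sin (theta \<kappa> s))) (at s)"
    and smooth_phi2: "smooth_on (ball 0 r) (phi2 \<kappa>)"
proof -
  have smooth: "smooth_on (ball 0 r) (\<lambda>s. s *\<^sub>R (cos (theta \<kappa> s), sin (theta \<kappa> s)))"
    by (intro smooth_on_intros open_ball smooth_theta[OF assms]
        smooth_on_compose[OF open_ball open_UNIV smooth_on_sin]
        smooth_on_compose[OF open_ball open_UNIV smooth_on_cos]) auto
  show *: "(phi2 \<kappa> has_vector_derivative s *\<^sub>R (cos (theta \<kappa> s), sin (theta \<kappa> s))) (at s)"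
    if "s \<in> ball 0 r" for s
    using has_vector_derivative_interval_integral[OF smooth_on_continuous[OF smooth] that]
    by (simp add: phi2_def[abs_def])
  show "smooth_on (ball 0 r) (phi2 \<kappa>)"
    by (rule smooth_on_vector_antiderivative[OF open_ball * smooth])
qed

lemma theta_tendsto_0:
  assumes "0 < r" "smooth_on (ball 0 r) \<kappa>"
  shows "theta \<kappa> \<midarrow>0\<rightarrow> 0"
proof -
  have "isCont (theta \<kappa>) 0"
    using smooth_on_continuous[OF smooth_theta[OF assms(2)]] \<open>0 < r\<close>
    by (simp add: continuous_on_eq_continuous_at)
  then show ?thesis by (simp add: isCont_def theta_at_0)
qed

lemma has_derivative_phi2_components:
  assumes "smooth_on (ball 0 r) \<kappa>" "s \<in> ball 0 r"
  shows "((\<lambda>s. fst (phi2 \<kappa> s)) has_real_derivative s * cos (theta \<kappa> s)) (at s)"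
    and "((\<lambda>s. snd (phi2 \<kappa> s)) has_real_derivative s * sin (theta \<kappa> s)) (at s)"
  using bounded_linear.has_vector_derivative[OF bounded_linear_fst has_derivative_phi2[OF assms]]
    bounded_linear.has_vector_derivative[OF bounded_linear_snd has_derivative_phi2[OF assms]]
  by (simp_all add: has_real_derivative_iff_has_vector_derivative)

section \<open>Leading terms at 0 by L'Hopital's rule\<close>

lemma lhopital_power:
  fixes f :: "real \<Rightarrow> real"
  assumes "0 < r" "\<And>s. s \<in> ball 0 r \<Longrightarrow> (f has_real_derivative f' s) (at s)" "f 0 = 0" "0 < N"
    "((\<lambda>s. f' s / s ^ (N - 1)) \<longlongrightarrow> L) (at 0)"
  shows "((\<lambda>s. f s / s ^ N) \<longlongrightarrow> L / N) (at 0)"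
proof (rule lhopital)
  have "isCont f 0" using assms(2)[of 0] \<open>0 < r\<close> DERIV_isCont by force
  then show "f \<midarrow>0\<rightarrow> 0" using assms(3) by (simp add: isCont_def)
  show "((\<lambda>s::real. s ^ N) \<longlongrightarrow> 0) (at 0)"
    by (rule tendsto_eq_rhs[OF tendsto_power[OF tendsto_ident_at]]) (use \<open>0 < N\<close> in simp)
  show "\<forall>\<^sub>F s::real in at 0. s ^ N \<noteq> 0" "\<forall>\<^sub>F s::real in at 0. real N * s ^ (N - 1) \<noteq> 0"
    by (rule eventually_mono[OF eventually_neq_at_within[of 0 0 UNIV]], use \<open>0 < N\<close> in simp)+
  show "\<forall>\<^sub>F s in at 0. (f has_real_derivative f' s) (at s)"
    using eventually_at_ball[OF \<open>0 < r\<close>, of 0 UNIV] by eventually_elim (use assms(2) in auto)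
  show "\<forall>\<^sub>F s::real in at 0. ((\<lambda>s. s ^ N) has_real_derivative real N * s ^ (N - 1)) (at s)"
    by (rule always_eventually) (use DERIV_pow in auto)
  from tendsto_mult_left[OF assms(5), of "inverse (real N)"]
  show "((\<lambda>s. f' s / (real N * s ^ (N - 1))) \<longlongrightarrow> L / N) (at 0)"
    by (simp add: field_simps)
qed

lemma tendsto_taylor_quotient:
  fixes F :: "nat \<Rightarrow> real \<Rightarrow> real"
  assumes "0 < r" "\<And>n s. s \<in> ball 0 r \<Longrightarrow> (F n has_real_derivative F (Suc n) s) (at s)"
    "\<And>i. i < N \<Longrightarrow> F i 0 = 0"
  shows "((\<lambda>s. F 0 s / s ^ N) \<longlongrightarrow> F N 0 / fact N) (at 0)"
  using assms(2,3)
proof (induction N arbitrary: F)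
  case 0
  then have "isCont (F 0) 0" using \<open>0 < r\<close> DERIV_isCont by force
  then show ?case by (simp add: isCont_def)
next
  case (Suc N)
  have "((\<lambda>s. F 1 s / s ^ (Suc N - 1)) \<longlongrightarrow> F (Suc N) 0 / fact N) (at 0)"
    using Suc.IH[of "\<lambda>n. F (Suc n)"] Suc.prems by auto
  then have "((\<lambda>s. F 0 s / s ^ Suc N) \<longlongrightarrow> F (Suc N) 0 / fact N / real (Suc N)) (at 0)"
    using Suc.prems by (intro lhopital_power[OF \<open>0 < r\<close>, where f' = "F 1"]) auto
  then show ?case by (simp add: mult.commute)
qed

lemma theta_odd_part_limit:
  assumes "0 < r" "smooth_on (ball 0 r) \<kappa>" "odd N"
    and "\<And>i. odd i \<Longrightarrow> i < N \<Longrightarrow> theta_coeff \<kappa> i = 0"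
  shows "((\<lambda>s. (theta \<kappa> s - theta \<kappa> (- s)) / s ^ N) \<longlongrightarrow> 2 * theta_coeff \<kappa> N / fact N) (at 0)"
proof -
  define T where "T n = (deriv ^^ n) (theta \<kappa>)" for n
  \<comment> \<open>The \<open>n\<close>-th derivative of
    \<open>theta \<kappa> s - theta \<kappa> (- s)\<close>. At 0 it is \<open>1 - (- 1) ^ n\<close>
    times the coefficient: even orders vanish by themselves, odd ones below \<open>N\<close> by
    hypothesis, and at \<open>N\<close> the factor is 2.\<close>
  define F where "F n s = T n s - (- 1) ^ n * T n (- s)" for n s
  have T: "(T n has_real_derivative T (Suc n) s) (at s)" if "s \<in> ball 0 r" for n s
    using smooth_on_iterated_deriv(2)[OF open_ball smooth_theta[OF assms(2)] that]
    by (simp only: T_def)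
  have "(F n has_real_derivative F (Suc n) s) (at s)" if s: "s \<in> ball 0 r" for n s
  proof -
    have "((\<lambda>s. T n (- s)) has_real_derivative T (Suc n) (- s) * (- 1)) (at s)"
      by (rule DERIV_chain2[where f = "T n" and g = uminus, OF T])
        (use s in \<open>auto intro!: derivative_eq_intros\<close>)
    from DERIV_diff[OF T[OF s, of n] DERIV_cmult[OF this, of "(- 1) ^ n"]]
    show ?thesis by (simp add: F_def[abs_def])
  qed
  moreover have "F i 0 = 0" if "i < N" for i
    using assms(4)[of i] that by (cases "even i") (auto simp: F_def T_def theta_coeff_def)
  ultimately have "((\<lambda>s. F 0 s / s ^ N) \<longlongrightarrow> F N 0 / fact N) (at 0)"
    by (rule tendsto_taylor_quotient[OF \<open>0 < r\<close>])
  then show ?thesis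
    using \<open>odd N\<close> by (simp add: F_def T_def theta_coeff_def)
qed

text \<open>Split \<open>theta \<kappa>\<close> into its even part \<open>e\<close> and odd part
  \<open>d\<close>. By the addition formulas the odd parts of the two components have derivatives
  \<open>- s * sin e * sin d\<close> and \<open>s * cos e * sin d\<close>. Since
  \<open>sin d\<close> has order at least \<open>2 * m - 1\<close> and \<open>e\<close> tends to 0,
  the first loses its leading term and the second keeps it; integration divides it by
  \<open>2 * m + 1\<close>.\<close>

lemma phi2_odd_part_limit:
  assumes "0 < r" "smooth_on (ball 0 r) \<kappa>" "1 \<le> m"
    and "\<And>i. odd i \<Longrightarrow> i < 2 * m - 1 \<Longrightarrow> theta_coeff \<kappa> i = 0"
  shows "((\<lambda>s. (fst (phi2 \<kappa> s) - fst (phi2 \<kappa> (- s))) / 2 / s ^ (2 * m + 1)) \<longlongrightarrow> 0) (at 0)"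
    and "((\<lambda>s. (snd (phi2 \<kappa> s) - snd (phi2 \<kappa> (- s))) / 2 / s ^ (2 * m + 1)) \<longlongrightarrow>
      theta_coeff \<kappa> (2 * m - 1) / (fact (2 * m - 1) * real (2 * m + 1))) (at 0)"
proof -
  let ?\<theta> = "theta \<kappa>"
  define e where "e s = (?\<theta> s + ?\<theta> (- s)) / 2" for s
  define d where "d s = (?\<theta> s - ?\<theta> (- s)) / 2" for s
  define c where "c = theta_coeff \<kappa> (2 * m - 1) / fact (2 * m - 1)"
  note lim = theta_tendsto_0[OF assms(1,2)]
  moreover have "filterlim (uminus :: real \<Rightarrow> real) (at 0) (at 0)"
    by (auto simp: filterlim_at eventually_at_filter intro!: tendsto_eq_intros)
  ultimately have lim': "((\<lambda>s. ?\<theta> (- s)) \<longlongrightarrow> 0) (at 0)"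
    by (rule filterlim_compose)
  have e: "(e \<longlongrightarrow> 0) (at 0)" and d0: "(d \<longlongrightarrow> 0) (at 0)"
    using tendsto_add[OF lim lim'] tendsto_diff[OF lim lim']
    by (auto simp: e_def[abs_def] d_def[abs_def] intro!: tendsto_eq_intros lim lim')
  have "((\<lambda>s. (?\<theta> s - ?\<theta> (- s)) / s ^ (2 * m - 1)) \<longlongrightarrow>
      2 * theta_coeff \<kappa> (2 * m - 1) / fact (2 * m - 1)) (at 0)"
    using theta_odd_part_limit[OF assms(1,2) _ assms(4)] \<open>1 \<le> m\<close> by simp
  from tendsto_mult_left[OF this, of "1 / 2"]
  have d: "((\<lambda>s. d s / s ^ (2 * m - 1)) \<longlongrightarrow> c) (at 0)"
    by (simp add: c_def d_def)
  \<comment> \<open>Caratheodory's form of the derivative of \<open>sin\<close> avoids a division by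
    \<open>d s\<close>, which may vanish arbitrarily near 0.\<close>
  obtain g where g: "\<And>z::real. sin z = g z * z" "isCont g 0" "g 0 = 1"
    using DERIV_sin[of "0::real"] unfolding CARAT_DERIV by auto
  have "((\<lambda>s. g (d s)) \<longlongrightarrow> 1) (at 0)"
    using isCont_tendsto_compose[OF g(2) d0] g(3) by simp
  from tendsto_mult[OF this d] have sin_d: "((\<lambda>s. sin (d s) / s ^ (2 * m - 1)) \<longlongrightarrow> c) (at 0)"
    by (simp add: g(1))
  have pw: "s ^ (2 * m) = s * s ^ (2 * m - 1)" for s :: real
    using \<open>1 \<le> m\<close> power_Suc[of s "2 * m - 1"] by simp
  have cancel: "\<forall>\<^sub>F s in at 0. a s * (b s / s ^ (2 * m - 1)) = s * (a s * b s) / s ^ (2 * m + 1 - 1)"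
    for a b :: "real \<Rightarrow> real"
    by (rule eventually_mono[OF eventually_neq_at_within[of 0 0 UNIV]]) (simp add: pw)
  note phi = has_derivative_phi2_components[OF assms(2)]
  have phi': "((\<lambda>s. fst (phi2 \<kappa> (- s))) has_real_derivative s * cos (?\<theta> (- s))) (at s)"
    "((\<lambda>s. snd (phi2 \<kappa> (- s))) has_real_derivative s * sin (?\<theta> (- s))) (at s)" if "s \<in> ball 0 r" for s
  proof -
    have "((\<lambda>s. fst (phi2 \<kappa> (- s))) has_real_derivative - s * cos (?\<theta> (- s)) * (- 1)) (at s)"
      by (rule DERIV_chain2[where f = "\<lambda>s. fst (phi2 \<kappa> s)" and g = uminus, OF phi(1)])
        (use that in \<open>auto intro!: derivative_eq_intros\<close>)
    then show "((\<lambda>s. fst (phi2 \<kappa> (- s))) has_real_derivative s * cos (?\<theta> (- s))) (at s)" by simp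
    have "((\<lambda>s. snd (phi2 \<kappa> (- s))) has_real_derivative - s * sin (?\<theta> (- s)) * (- 1)) (at s)"
      by (rule DERIV_chain2[where f = "\<lambda>s. snd (phi2 \<kappa> s)" and g = uminus, OF phi(2)])
        (use that in \<open>auto intro!: derivative_eq_intros\<close>)
    then show "((\<lambda>s. snd (phi2 \<kappa> (- s))) has_real_derivative s * sin (?\<theta> (- s))) (at s)" by simp
  qed
  have ed: "?\<theta> s = e s + d s" "?\<theta> (- s) = e s - d s" for s
    by (simp_all add: e_def d_def field_simps)
  have "((\<lambda>s. (fst (phi2 \<kappa> s) - fst (phi2 \<kappa> (- s))) / 2 / s ^ (2 * m + 1)) \<longlongrightarrow>
      0 / real (2 * m + 1)) (at 0)"
  proof (rule lhopital_power[OF \<open>0 < r\<close>])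
    show "((\<lambda>s. (fst (phi2 \<kappa> s) - fst (phi2 \<kappa> (- s))) / 2) has_real_derivative
        - (s * (sin (e s) * sin (d s)))) (at s)" if "s \<in> ball 0 r" for s
      using DERIV_cdivide[OF DERIV_diff[OF phi(1)[OF that] phi'(1)[OF that]], of 2]
      by (rule DERIV_cong) (simp add: ed[of s] cos_add cos_diff algebra_simps)
    have "((\<lambda>s. - (sin (e s) * (sin (d s) / s ^ (2 * m - 1)))) \<longlongrightarrow> 0) (at 0)"
      by (rule tendsto_eq_rhs[OF tendsto_minus[OF tendsto_mult[OF tendsto_sin[OF e] sin_d]]]) simp
    then show "((\<lambda>s. - (s * (sin (e s) * sin (d s))) / s ^ (2 * m + 1 - 1)) \<longlongrightarrow> 0) (at 0)"
      by (rule Lim_transform_eventually)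
        (use cancel[of "\<lambda>s. - sin (e s)" "\<lambda>s. sin (d s)"] in simp)
  qed auto
  then show "((\<lambda>s. (fst (phi2 \<kappa> s) - fst (phi2 \<kappa> (- s))) / 2 / s ^ (2 * m + 1)) \<longlongrightarrow> 0) (at 0)"
    by simp
  have "((\<lambda>s. (snd (phi2 \<kappa> s) - snd (phi2 \<kappa> (- s))) / 2 / s ^ (2 * m + 1)) \<longlongrightarrow>
      c / real (2 * m + 1)) (at 0)"
  proof (rule lhopital_power[OF \<open>0 < r\<close>])
    show "((\<lambda>s. (snd (phi2 \<kappa> s) - snd (phi2 \<kappa> (- s))) / 2) has_real_derivative
        s * (cos (e s) * sin (d s))) (at s)" if "s \<in> ball 0 r" for s
      using DERIV_cdivide[OF DERIV_diff[OF phi(2)[OF that] phi'(2)[OF that]], of 2]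
      by (rule DERIV_cong) (simp add: ed[of s] sin_add sin_diff algebra_simps)
    have "((\<lambda>s. cos (e s) * (sin (d s) / s ^ (2 * m - 1))) \<longlongrightarrow> c) (at 0)"
      by (rule tendsto_eq_rhs[OF tendsto_mult[OF tendsto_cos[OF e] sin_d]]) simp
    then show "((\<lambda>s. s * (cos (e s) * sin (d s)) / s ^ (2 * m + 1 - 1)) \<longlongrightarrow> c) (at 0)"
      by (rule Lim_transform_eventually[OF _ cancel])
  qed auto
  then show "((\<lambda>s. (snd (phi2 \<kappa> s) - snd (phi2 \<kappa> (- s))) / 2 / s ^ (2 * m + 1)) \<longlongrightarrow>
      theta_coeff \<kappa> (2 * m - 1) / (fact (2 * m - 1) * real (2 * m + 1))) (at 0)"
    by (simp add: c_def)
qed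

lemma phi2_quadratic_limit:
  assumes "0 < r" "smooth_on (ball 0 r) \<kappa>"
  shows "((\<lambda>s. fst (phi2 \<kappa> s) / s ^ 2) \<longlongrightarrow> 1 / 2) (at 0)"
    and "((\<lambda>s. snd (phi2 \<kappa> s) / s ^ 2) \<longlongrightarrow> 0) (at 0)"
proof -
  let ?\<theta> = "theta \<kappa>"
  note lim = theta_tendsto_0[OF assms(1,2)]
  note phi = has_derivative_phi2_components[OF assms(2)]
  have "((\<lambda>s. s * cos (?\<theta> s) / s ^ (2 - 1)) \<longlongrightarrow> cos 0) (at 0)"
    using tendsto_cos[OF lim] by (rule Lim_transform_eventually) (auto simp: eventually_at_filter)
  from lhopital_power[OF \<open>0 < r\<close> phi(1) _ _ this]
  show "((\<lambda>s. fst (phi2 \<kappa> s) / s ^ 2) \<longlongrightarrow> 1 / 2) (at 0)" by (simp add: phi2_at_0)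
  have "((\<lambda>s. s * sin (?\<theta> s) / s ^ (2 - 1)) \<longlongrightarrow> sin 0) (at 0)"
    using tendsto_sin[OF lim] by (rule Lim_transform_eventually) (auto simp: eventually_at_filter)
  from lhopital_power[OF \<open>0 < r\<close> phi(2) _ _ this]
  show "((\<lambda>s. snd (phi2 \<kappa> s) / s ^ 2) \<longlongrightarrow> 0) (at 0)" by (simp add: phi2_at_0)
qed

text \<open>As \<open>N \<ge> 3\<close>, the term \<open>s ^ N * B (s ^ 2)\<close> is negligible
  against \<open>s ^ 2\<close>, so the quadratic coefficient of \<open>f\<close> is the linear
  coefficient of \<open>A\<close>. Only arguments \<open>s ^ 2 > 0\<close> are seen, which is enough
  since \<open>A\<close> is known to be differentiable.\<close>

lemma decomposition_derivative:
  fixes f A B :: "real \<Rightarrow> real"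
  assumes "0 < r" "3 \<le> N" "smooth_on (ball 0 (r ^ 2)) A" "smooth_on (ball 0 (r ^ 2)) B"
    and f: "\<And>s. s \<in> ball 0 r \<Longrightarrow> f s = A (s ^ 2) + s ^ N * B (s ^ 2)"
    and "f 0 = 0" and lim: "((\<lambda>s. f s / s ^ 2) \<longlongrightarrow> a) (at 0)"
  shows "A 0 = 0" and "(A has_real_derivative a) (at 0)"
proof -
  have 0: "0 \<in> ball 0 (r ^ 2)" using \<open>0 < r\<close> by simp
  show A0: "A 0 = 0" using f[of 0] assms(1,2,6) by (simp add: power_0_left)
  have dA: "(A has_real_derivative deriv A 0) (at 0)"
    using smooth_on_deriv(1)[OF open_ball assms(3) 0] .
  have sq: "filterlim (\<lambda>s::real. s ^ 2) (at 0) (at 0)"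
    by (auto simp: filterlim_at eventually_at_filter intro!: tendsto_eq_intros)
  have "((\<lambda>X. A X / X) \<longlongrightarrow> deriv A 0) (at 0)"
    using dA by (simp add: has_field_derivative_iff A0)
  from filterlim_compose[OF this sq]
  have 1: "((\<lambda>s. A (s ^ 2) / s ^ 2) \<longlongrightarrow> deriv A 0) (at 0)" .
  have "isCont B 0"
    using smooth_on_continuous[OF assms(4)] 0 by (simp add: continuous_on_eq_continuous_at)
  then have "((\<lambda>s. B (s ^ 2)) \<longlongrightarrow> B 0) (at 0)"
    using filterlim_compose[OF _ sq, of B "nhds (B 0)"] by (simp add: isCont_def)
  from tendsto_mult[OF tendsto_power[OF tendsto_ident_at, of "N - 2"] this]
  have "((\<lambda>s. s ^ (N - 2) * B (s ^ 2)) \<longlongrightarrow> 0) (at 0)"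
    using \<open>3 \<le> N\<close> by (simp add: power_0_left)
  from tendsto_add[OF 1 this]
  have "((\<lambda>s. A (s ^ 2) / s ^ 2 + s ^ (N - 2) * B (s ^ 2)) \<longlongrightarrow> deriv A 0) (at 0)" by simp
  then have "((\<lambda>s. f s / s ^ 2) \<longlongrightarrow> deriv A 0) (at 0)"
  proof (rule Lim_transform_eventually)
    have "s ^ N = s ^ 2 * s ^ (N - 2)" for s :: real
    proof -
      have "N = 2 + (N - 2)" using \<open>3 \<le> N\<close> by simp
      then show ?thesis by (metis power_add)
    qed
    then have "A (s ^ 2) / s ^ 2 + s ^ (N - 2) * B (s ^ 2) = f s / s ^ 2"
      if "s \<in> ball 0 r" "s \<noteq> 0" for s
      using f[OF that(1)] that(2) by (simp add: field_simps)
    then show "\<forall>\<^sub>F s in at 0. A (s ^ 2) / s ^ 2 + s ^ (N - 2) * B (s ^ 2) = f s / s ^ 2"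
      using eventually_at_ball'[OF \<open>0 < r\<close>, of 0 UNIV] by (auto elim!: eventually_mono)
  qed
  then have "deriv A 0 = a"
    using lim tendsto_unique[of "at (0::real)"] by (simp add: LIM_unique)
  then show "(A has_real_derivative a) (at 0)" using dA by simp
qed

text \<open>The coefficient of index \<open>2 * m - 1\<close> may be 0 here, so that
  \<open>\<Psi>\<close> may have a singular derivative: the converse needs this form for every
  \<open>m \<le> k\<close> before the coefficient is known.\<close>

lemma phi2_normal_form:
  assumes "smooth_germ \<kappa>" "1 \<le> m"
    and "\<And>i. odd i \<Longrightarrow> i < 2 * m - 1 \<Longrightarrow> theta_coeff \<kappa> i = 0"
  obtains U \<Psi> where "open U" "0 \<in> U" "smooth_on U \<Psi>" "\<Psi> 0 = 0"
    "(\<Psi> has_derivative (\<lambda>p. (fst p / 2,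
      theta_coeff \<kappa> (2 * m - 1) / (fact (2 * m - 1) * real (2 * m + 1)) * snd p))) (at 0)"
    "\<forall>\<^sub>F t in nhds 0. phi2 \<kappa> t = \<Psi> (t ^ 2, t ^ (2 * m + 1))"
proof -
  let ?N = "2 * m + 1"
  define c where "c = theta_coeff \<kappa> (2 * m - 1) / (fact (2 * m - 1) * real ?N)"
  obtain r where r: "0 < r" "smooth_on (ball 0 r) \<kappa>"
    using assms(1) unfolding smooth_germ_def by (meson open_contains_ball smooth_on_subset)
  have N: "odd ?N" "3 \<le> ?N" using assms(2) by auto
  have S: "smooth_on (ball 0 r) (\<lambda>s. fst (phi2 \<kappa> s))" "smooth_on (ball 0 r) (\<lambda>s. snd (phi2 \<kappa> s))"
    by (intro smooth_on_intros open_ball smooth_phi2[OF r(2)])+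
  obtain A1 B1 where 1: "smooth_on (ball 0 (r ^ 2)) A1" "smooth_on (ball 0 (r ^ 2)) B1" "B1 0 = 0"
    "\<And>s. s \<in> ball 0 r \<Longrightarrow> fst (phi2 \<kappa> s) = A1 (s ^ 2) + s ^ ?N * B1 (s ^ 2)"
    using even_odd_decomposition[OF r(1) S(1) N(1) phi2_odd_part_limit(1)[OF r assms(2,3)]] by metis
  obtain A2 B2 where 2: "smooth_on (ball 0 (r ^ 2)) A2" "smooth_on (ball 0 (r ^ 2)) B2" "B2 0 = c"
    "\<And>s. s \<in> ball 0 r \<Longrightarrow> snd (phi2 \<kappa> s) = A2 (s ^ 2) + s ^ ?N * B2 (s ^ 2)"
    using even_odd_decomposition[OF r(1) S(2) N(1) phi2_odd_part_limit(2)[OF r assms(2,3)]]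
    unfolding c_def by metis
  have A1: "A1 0 = 0" "(A1 has_real_derivative 1 / 2) (at 0)"
    using decomposition_derivative[OF r(1) N(2) 1(1,2,4) _ phi2_quadratic_limit(1)[OF r]]
    by (simp_all add: phi2_at_0)
  have A2: "A2 0 = 0" "(A2 has_real_derivative 0) (at 0)"
    using decomposition_derivative[OF r(1) N(2) 2(1,2,4) _ phi2_quadratic_limit(2)[OF r]]
    by (simp_all add: phi2_at_0)
  define U where "U = ball (0::real) (r ^ 2) \<times> (UNIV :: real set)"
  define \<Psi> where "\<Psi> p = (A1 (fst p) + snd p * B1 (fst p), A2 (fst p) + snd p * B2 (fst p))"
    for p :: "real \<times> real"
  have U: "open U" "0 \<in> U"
    using r(1) by (auto simp: U_def zero_prod_def intro: open_Times)
  have lift: "smooth_on U (\<lambda>p. g (fst p))" if "smooth_on (ball 0 (r ^ 2)) g" for g :: "real \<Rightarrow> real"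
    by (rule smooth_on_compose[OF U(1) open_ball that smooth_on_linear[OF U(1) bounded_linear_fst]])
      (auto simp: U_def)
  have "smooth_on U \<Psi>"
    unfolding \<Psi>_def[abs_def]
    by (intro smooth_on_Pair smooth_on_add smooth_on_mult lift 1 2 U smooth_on_snd smooth_on_ident)
  moreover have "\<Psi> 0 = 0" by (simp add: \<Psi>_def A1 A2 zero_prod_def)
  moreover have "(\<Psi> has_derivative (\<lambda>p. (fst p / 2, c * snd p))) (at 0)"
  proof -
    \<comment> \<open>At 0 the product \<open>snd p * B (fst p)\<close> contributes only
      \<open>B 0 * snd p\<close>, because \<open>snd\<close> vanishes there. The off-diagonal
      entries of the derivative of \<open>\<Psi>\<close> are then \<open>B1 0\<close> and the
      derivative of \<open>A2\<close> at 0, both equal to 0.\<close>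
    have comp: "((\<lambda>p. A (fst p) + snd p * B (fst p)) has_derivative (\<lambda>p. a * fst p + B 0 * snd p)) (at 0)"
      if "(A has_real_derivative a) (at 0)" "smooth_on (ball 0 (r ^ 2)) B" for A B :: "real \<Rightarrow> real" and a
    proof -
      have B: "(B has_derivative (\<lambda>v. deriv B 0 * v)) (at 0)"
        using smooth_on_deriv(1)[OF open_ball that(2), of 0] r(1) by (simp add: has_field_derivative_def)
      have A: "(A has_derivative (\<lambda>v. a * v)) (at 0)"
        using that(1) by (simp add: has_field_derivative_def)
      have fst: "(fst has_derivative fst) (at (0 :: real \<times> real))"
        and snd: "(snd has_derivative snd) (at (0 :: real \<times> real))"
        by (auto intro!: bounded_linear_imp_has_derivative bounded_linear_fst bounded_linear_snd)
      have "((\<lambda>p::real \<times> real. A (fst p)) has_derivative (\<lambda>p. a * fst p)) (at 0)"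
        "((\<lambda>p::real \<times> real. B (fst p)) has_derivative (\<lambda>p. deriv B 0 * fst p)) (at 0)"
        using has_derivative_compose[OF fst, of A] has_derivative_compose[OF fst, of B] A B by auto
      from has_derivative_add[OF this(1) has_derivative_mult[OF snd this(2)]]
      show ?thesis by (simp add: mult.commute)
    qed
    show ?thesis
      unfolding \<Psi>_def[abs_def]
      using has_derivative_Pair[OF comp[OF A1(2) 1(2)] comp[OF A2(2) 2(2)]] by (simp add: 1(3) 2(3))
  qed
  moreover have "\<forall>\<^sub>F t in nhds 0. phi2 \<kappa> t = \<Psi> (t ^ 2, t ^ ?N)"
  proof -
    have "\<forall>\<^sub>F t in nhds (0::real). t \<in> ball 0 r"
      using r(1) by (intro eventually_nhds_in_open) auto
    then show ?thesis
      by eventually_elim (simp only: \<Psi>_def prod_eq_iff 1(4) 2(4) fst_conv snd_conv)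
  qed
  ultimately show ?thesis using that U unfolding c_def by blast
qed

subsection \<open>Comparison of odd parts\<close>

text \<open>The error is an arbitrarily small multiple of \<open>norm (u t - v t)\<close>, hence of
  \<open>\<bar>t\<bar> ^ N\<close>. The rate is imposed on the difference alone; \<open>u\<close>
  and \<open>v\<close> themselves may tend to 0 more slowly, as the squares do later.\<close>

lemma strict_derivative_small:
  fixes f :: "'a::euclidean_space \<Rightarrow> 'b::euclidean_space" and u v :: "real \<Rightarrow> 'a"
  assumes "open U" "0 \<in> U" "smooth_on U f" "(f has_derivative D) (at 0)"
    and "(u \<longlongrightarrow> 0) (at 0)" "(v \<longlongrightarrow> 0) (at 0)"
    and bound: "\<forall>\<^sub>F t in at 0. norm (u t - v t) \<le> C * \<bar>t\<bar> ^ N"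
  shows "((\<lambda>t. (1 / t ^ N) *\<^sub>R (f (u t) - f (v t) - D (u t - v t))) \<longlongrightarrow> 0) (at 0)"
proof (rule tendstoI)
  fix e :: real assume "0 < e"
  define e' where "e' = e / (\<bar>C\<bar> + 1)"
  have "0 < e'" using \<open>0 < e\<close> by (simp add: e'_def)
  then obtain d where d: "0 < d"
    "\<And>x y. x \<in> ball 0 d \<Longrightarrow> y \<in> ball 0 d \<Longrightarrow> norm (f x - f y - D (x - y)) \<le> e' * norm (x - y)"
    using smooth_on_strict_derivative[OF assms(1-4)] by metis
  have "\<forall>\<^sub>F t in at 0. u t \<in> ball 0 d" "\<forall>\<^sub>F t in at 0. v t \<in> ball 0 d"
    by (rule topological_tendstoD[OF assms(5) open_ball], use d(1) in simp)
      (rule topological_tendstoD[OF assms(6) open_ball], use d(1) in simp)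
  then show "\<forall>\<^sub>F t in at 0. dist ((1 / t ^ N) *\<^sub>R (f (u t) - f (v t) - D (u t - v t))) 0 < e"
    using bound eventually_neq_at_within[of 0 0 UNIV]
  proof eventually_elim
    case (elim t)
    define z where "z = f (u t) - f (v t) - D (u t - v t)"
    have "norm z \<le> e' * (C * \<bar>t\<bar> ^ N)"
      using d(2)[OF elim(1,2)] elim(3) \<open>0 < e'\<close> unfolding z_def by (smt (verit) mult_left_mono)
    then have "dist ((1 / t ^ N) *\<^sub>R z) 0 \<le> e' * C"
      using elim(4) by (simp add: field_simps power_abs)
    also have "e' * C < e' * (\<bar>C\<bar> + 1)"
      using \<open>0 < e'\<close> by (intro mult_strict_left_mono) auto
    also have "\<dots> = e"
      by (simp add: e'_def)
    finally show ?case by (simp only: z_def)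
  qed
qed

lemma tendsto_quotient_imp_bound:
  fixes g :: "real \<Rightarrow> 'a::real_normed_vector"
  assumes "((\<lambda>t. (1 / t ^ N) *\<^sub>R g t) \<longlongrightarrow> l) (at 0)"
  shows "\<forall>\<^sub>F t in at 0. norm (g t) \<le> (norm l + 1) * \<bar>t\<bar> ^ N"
proof -
  have "\<forall>\<^sub>F t in at 0. norm ((1 / t ^ N) *\<^sub>R g t) < norm l + 1"
    using tendsto_norm[OF assms] by (rule order_tendstoD) simp
  then show ?thesis
    using eventually_neq_at_within[of 0 0 UNIV]
    by eventually_elim (simp add: field_simps power_abs)
qed

text \<open>For odd \<open>N\<close> the sign in \<open>h (- t) / (- t)\<close> turns the difference
  of powers into a sum, so the two limits \<open>\<eta> ^ N\<close> add up instead of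
  cancelling.\<close>

lemma tendsto_power_difference:
  fixes h :: "real \<Rightarrow> real"
  assumes "(h has_real_derivative \<eta>) (at 0)" "h 0 = 0" "odd N"
  shows "((\<lambda>t. (h t ^ N - h (- t) ^ N) / t ^ N) \<longlongrightarrow> 2 * \<eta> ^ N) (at 0)"
proof -
  have 1: "((\<lambda>t. h t / t) \<longlongrightarrow> \<eta>) (at 0)"
    using assms(1,2) by (simp add: has_field_derivative_iff)
  moreover have "filterlim (uminus :: real \<Rightarrow> real) (at 0) (at 0)"
    by (auto simp: filterlim_at eventually_at_filter intro!: tendsto_eq_intros)
  ultimately have 2: "((\<lambda>t. h (- t) / (- t)) \<longlongrightarrow> \<eta>) (at 0)"
    by (rule filterlim_compose)
  have "((\<lambda>t. (h t / t) ^ N + (h (- t) / (- t)) ^ N) \<longlongrightarrow> \<eta> ^ N + \<eta> ^ N) (at 0)"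
    by (intro tendsto_intros 1 2)
  moreover have "(h t / t) ^ N + (h (- t) / (- t)) ^ N = (h t ^ N - h (- t) ^ N) / t ^ N" for t
    using \<open>odd N\<close> by (simp add: power_divide diff_divide_distrib)
  ultimately show ?thesis by simp
qed

text \<open>
  The two sides of the equation at \<open>t\<close> and at \<open>- t\<close> are subtracted, which leaves the odd parts: by
  strict differentiability both differences are, to order \<open>N\<close>, given by the derivatives at \<open>0\<close>.
\<close>

lemma cusp_equivalence_coefficient:
  fixes f :: "real \<Rightarrow> real \<times> real"
  assumes \<Psi>: "open U" "0 \<in> U" "smooth_on U \<Psi>" "\<Psi> 0 = 0"
      "(\<Psi> has_derivative (\<lambda>p. (fst p / 2, c * snd p))) (at 0)"
    and f: "\<forall>\<^sub>F t in nhds 0. f t = \<Psi> (t ^ 2, t ^ N)"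
    and h: "(h has_real_derivative \<eta>) (at 0)" "h 0 = 0"
    and \<psi>: "open V" "0 \<in> V" "smooth_on V \<psi>" "\<psi> 0 = 0" "(\<psi> has_derivative E) (at 0)"
    and eq: "\<forall>\<^sub>F t in nhds 0. f (h t) = \<psi> (t ^ 2, t ^ M)"
    and NM: "odd N" "odd M" "3 \<le> N" "N \<le> M"
  shows "c * \<eta> ^ N = 0 ^ (M - N) * snd (E (0, 1))" and "snd (E (1, 0)) = 0"
proof -
  let ?D = "\<lambda>p. (fst p / 2, c * snd p)"
  define b where "b t = h (- t)" for t
  define \<delta> where "\<delta> t = f (h t) - f (b t)" for t
  \<comment> \<open>\<open>0 ^ (M - N)\<close> is the limit of \<open>t ^ (M - N)\<close>: 1 for
    \<open>M = N\<close> and 0 for \<open>M > N\<close>, so one formula serves both cases.\<close>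
  define l where "l = (2 * 0 ^ (M - N)) *\<^sub>R E (0, 1)"
  have linE: "linear E" using \<psi>(5) has_derivative_linear by blast
  have h0: "(h \<longlongrightarrow> 0) (at 0)" using DERIV_isCont[OF h(1)] h(2) by (simp add: isCont_def)
  have neg: "filterlim (uminus :: real \<Rightarrow> real) (at 0) (at 0)"
    by (auto simp: filterlim_at eventually_at_filter intro!: tendsto_eq_intros)
  have b0: "(b \<longlongrightarrow> 0) (at 0)"
    unfolding b_def by (rule filterlim_compose[OF h0 neg])
  have pow0: "((\<lambda>t. g t ^ n) \<longlongrightarrow> 0) F" if "(g \<longlongrightarrow> 0) F" "0 < n" for g :: "real \<Rightarrow> real" and n F
    using tendsto_power[OF that(1), of n] that(2) by (simp add: power_0_left)
  have pair0: "((\<lambda>t. (g1 t, g2 t)) \<longlongrightarrow> 0) F" if "(g1 \<longlongrightarrow> 0) F" "(g2 \<longlongrightarrow> 0) F"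
    for g1 g2 :: "real \<Rightarrow> real" and F
    using tendsto_Pair[OF that] by (simp add: zero_prod_def)
  have id0: "((\<lambda>t::real. t) \<longlongrightarrow> 0) (at 0)" by (rule tendsto_ident_at)
  have u0: "((\<lambda>t. (h t ^ 2, h t ^ N)) \<longlongrightarrow> 0) (at 0)" "((\<lambda>t. (b t ^ 2, b t ^ N)) \<longlongrightarrow> 0) (at 0)"
    using NM(3) by (auto intro!: pair0 pow0 h0 b0)
  have fh: "\<forall>\<^sub>F t in at 0. f (h t) = \<Psi> (h t ^ 2, h t ^ N)"
    using eventually_compose_filterlim[OF f h0] .
  have fb: "\<forall>\<^sub>F t in at 0. f (b t) = \<Psi> (b t ^ 2, b t ^ N)"
    using eventually_compose_filterlim[OF f b0] .
  have eq1: "\<forall>\<^sub>F t in at 0. f (h t) = \<psi> (t ^ 2, t ^ M)"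
    using eventually_compose_filterlim[OF eq id0] .
  have "\<forall>\<^sub>F t in at 0. f (h (- t)) = \<psi> ((- t) ^ 2, (- t) ^ M)"
    by (rule eventually_compose_filterlim[OF eq]) (auto intro!: tendsto_eq_intros)
  then have eq2: "\<forall>\<^sub>F t in at 0. f (b t) = \<psi> (t ^ 2, - (t ^ M))"
    using NM(2) by (simp add: b_def)

  \<comment> \<open>On the \<open>\<psi>\<close> side the two arguments differ by
    \<open>(0, 2 * t ^ M)\<close>, which is of order \<open>N\<close> at once because
    \<open>N \<le> M\<close>.\<close>
  have "((\<lambda>t. (1 / t ^ N) *\<^sub>R (\<psi> (t ^ 2, t ^ M) - \<psi> (t ^ 2, - (t ^ M))
      - E ((t ^ 2, t ^ M) - (t ^ 2, - (t ^ M))))) \<longlongrightarrow> 0) (at 0)"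
  proof (rule strict_derivative_small[OF \<psi>(1,2,3,5)])
    show "((\<lambda>t::real. (t ^ 2, t ^ M)) \<longlongrightarrow> 0) (at 0)" "((\<lambda>t::real. (t ^ 2, - (t ^ M))) \<longlongrightarrow> 0) (at 0)"
      using NM by (auto intro!: pair0 pow0 id0 tendsto_minus_cancel[of "\<lambda>t. - (t ^ M)"])
    have "norm ((t ^ 2, t ^ M) - (t ^ 2, - (t ^ M))) \<le> 2 * \<bar>t\<bar> ^ N" if "\<bar>t\<bar> < 1" for t :: real
      using power_decreasing[of N M "\<bar>t\<bar>"] that NM by (simp add: norm_Pair power_abs real_sqrt_mult)
    then show "\<forall>\<^sub>F t::real in at 0. norm ((t ^ 2, t ^ M) - (t ^ 2, - (t ^ M))) \<le> 2 * \<bar>t\<bar> ^ N"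
      using eventually_at_ball[of 1 0 UNIV] by (auto elim!: eventually_mono)
  qed
  then have "((\<lambda>t. (1 / t ^ N) *\<^sub>R \<delta> t - (2 * t ^ (M - N)) *\<^sub>R E (0, 1)) \<longlongrightarrow> 0) (at 0)"
  proof (rule Lim_transform_eventually)
    have scale: "(1 / t ^ N) *\<^sub>R E (0, 2 * t ^ M) = (2 * t ^ (M - N)) *\<^sub>R E (0, 1)" if "t \<noteq> 0" for t
    proof -
      have "E (0, 2 * t ^ M) = (2 * t ^ M) *\<^sub>R E (0, 1)"
        using linear_scale[OF linE, of "2 * t ^ M" "(0, 1)"] by simp
      then show ?thesis using that NM(4) by (simp add: power_diff)
    qed
    show "\<forall>\<^sub>F t in at 0. (1 / t ^ N) *\<^sub>R (\<psi> (t ^ 2, t ^ M) - \<psi> (t ^ 2, - (t ^ M))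
      - E ((t ^ 2, t ^ M) - (t ^ 2, - (t ^ M)))) = (1 / t ^ N) *\<^sub>R \<delta> t - (2 * t ^ (M - N)) *\<^sub>R E (0, 1)"
      using eq1 eq2 eventually_neq_at_within[of 0 0 UNIV]
      by eventually_elim (simp add: \<delta>_def scaleR_diff_right scale)
  qed
  from tendsto_add[OF this tendsto_scaleR[OF tendsto_mult[OF tendsto_const[of 2] tendsto_power[OF id0, of "M - N"]]
      tendsto_const[of "E (0, 1)"]]]
  have \<delta>_lim: "((\<lambda>t. (1 / t ^ N) *\<^sub>R \<delta> t) \<longlongrightarrow> l) (at 0)"
    by (simp add: l_def)
  have pow_lim: "((\<lambda>t. (h t ^ N - b t ^ N) / t ^ N) \<longlongrightarrow> 2 * \<eta> ^ N) (at 0)"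
    unfolding b_def by (rule tendsto_power_difference[OF h NM(1)])
  have pow_bound: "\<forall>\<^sub>F t in at 0. \<bar>h t ^ N - b t ^ N\<bar> \<le> (\<bar>2 * \<eta> ^ N\<bar> + 1) * \<bar>t\<bar> ^ N"
    using tendsto_quotient_imp_bound[of N "\<lambda>t. h t ^ N - b t ^ N" "2 * \<eta> ^ N"] pow_lim by simp
  \<comment> \<open>Nothing is known yet about the size of \<open>h t ^ 2 - b t ^ 2\<close>. Since
    \<open>?D\<close> only halves it, an error of a quarter can be absorbed, which bounds it by
    \<open>\<delta> t\<close> and the difference of the \<open>N\<close>-th powers, both already
    controlled.\<close>
  have "(0::real) < 1 / 4" by simp
  from smooth_on_strict_derivative[OF \<Psi>(1,2,3,5) this]
  obtain d where d: "0 < d" "\<And>x y. x \<in> ball 0 d \<Longrightarrow> y \<in> ball 0 d \<Longrightarrow>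
      norm (\<Psi> x - \<Psi> y - ?D (x - y)) \<le> (1 / 4) * norm (x - y)"
    by blast
  have fst_le: "\<bar>fst z\<bar> \<le> norm z" for z :: "real \<times> real"
    using norm_fst_le[of "fst z" "snd z"] by simp
  have absorb: "\<bar>p\<bar> + \<bar>q\<bar> \<le> 4 * n + 2 * \<bar>q\<bar>"
    if "\<bar>x - p / 2\<bar> \<le> (1 / 4) * (\<bar>p\<bar> + \<bar>q\<bar>)" "\<bar>x\<bar> \<le> n" for x p q n :: real
    using that by argo
  define C where "C = 4 * (norm l + 1) + 2 * (\<bar>2 * \<eta> ^ N\<bar> + 1)"
  have "\<forall>\<^sub>F t in at 0. norm ((h t ^ 2, h t ^ N) - (b t ^ 2, b t ^ N)) \<le> C * \<bar>t\<bar> ^ N"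
    using fh fb pow_bound tendsto_quotient_imp_bound[OF \<delta>_lim]
      topological_tendstoD[OF u0(1) open_ball, of 0 d, unfolded centre_in_ball, OF d(1)]
      topological_tendstoD[OF u0(2) open_ball, of 0 d, unfolded centre_in_ball, OF d(1)]
  proof eventually_elim
    case (elim t)
    let ?p = "h t ^ 2 - b t ^ 2" and ?q = "h t ^ N - b t ^ N"
    have pq: "norm (?p, ?q) \<le> \<bar>?p\<bar> + \<bar>?q\<bar>"
      using norm_Pair_le[of ?p ?q] by simp
    have "norm (\<delta> t - (?p / 2, c * ?q)) \<le> (1 / 4) * norm (?p, ?q)"
      using d(2)[OF elim(5,6)] by (simp add: \<delta>_def elim(1,2))
    then have "\<bar>fst (\<delta> t) - ?p / 2\<bar> \<le> (1 / 4) * (\<bar>?p\<bar> + \<bar>?q\<bar>)"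
      using pq fst_le[of "\<delta> t - (?p / 2, c * ?q)"] by simp
    moreover have "\<bar>fst (\<delta> t)\<bar> \<le> norm (\<delta> t)"
      by (rule fst_le)
    ultimately have "\<bar>?p\<bar> + \<bar>?q\<bar> \<le> 4 * norm (\<delta> t) + 2 * \<bar>?q\<bar>" by (rule absorb)
    also have "\<dots> \<le> C * \<bar>t\<bar> ^ N"
      using elim(3,4) by (simp add: C_def algebra_simps)
    finally show ?case using pq by simp
  qed
  from strict_derivative_small[OF \<Psi>(1,2,3,5) u0 this]
  have "((\<lambda>t. (1 / t ^ N) *\<^sub>R (\<Psi> (h t ^ 2, h t ^ N) - \<Psi> (b t ^ 2, b t ^ N) -
      ?D ((h t ^ 2, h t ^ N) - (b t ^ 2, b t ^ N)))) \<longlongrightarrow> 0) (at 0)" .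
  \<comment> \<open>In the second component \<open>?D\<close> sees only the \<open>N\<close>-th
    powers, with factor \<open>c\<close>; the difference of squares drops out.\<close>
  from tendsto_snd[OF this]
  have "((\<lambda>t. snd ((1 / t ^ N) *\<^sub>R \<delta> t) - c * ((h t ^ N - b t ^ N) / t ^ N)) \<longlongrightarrow> snd (0 :: real \<times> real)) (at 0)"
  proof (rule Lim_transform_eventually)
    show "\<forall>\<^sub>F t in at 0. snd ((1 / t ^ N) *\<^sub>R (\<Psi> (h t ^ 2, h t ^ N) - \<Psi> (b t ^ 2, b t ^ N) -
      ?D ((h t ^ 2, h t ^ N) - (b t ^ 2, b t ^ N)))) =
      snd ((1 / t ^ N) *\<^sub>R \<delta> t) - c * ((h t ^ N - b t ^ N) / t ^ N)"
      using fh fb by eventually_elim (simp add: \<delta>_def algebra_simps diff_divide_distrib)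
  qed
  moreover have "((\<lambda>t. snd ((1 / t ^ N) *\<^sub>R \<delta> t) - c * ((h t ^ N - b t ^ N) / t ^ N)) \<longlongrightarrow>
      snd l - c * (2 * \<eta> ^ N)) (at 0)"
    by (intro tendsto_intros \<delta>_lim pow_lim)
  ultimately have "snd l - c * (2 * \<eta> ^ N) = snd (0 :: real \<times> real)"
    using LIM_unique by blast
  then show "c * \<eta> ^ N = 0 ^ (M - N) * snd (E (0, 1))"
    by (simp add: l_def)

  \<comment> \<open>Now the second components to order 2. On the \<open>\<Psi>\<close> side the
    limit is 0, since \<open>?D\<close> sends the square to the first coordinate and
    \<open>N \<ge> 3\<close>; on the \<open>\<psi>\<close> side it is
    \<open>snd (E (1, 0))\<close>.\<close>
  have h_sq: "((\<lambda>t. h t / t) \<longlongrightarrow> \<eta>) (at 0)"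
    using h by (simp add: has_field_derivative_iff)
  have hN: "((\<lambda>t. h t ^ N / t ^ 2) \<longlongrightarrow> 0) (at 0)"
  proof -
    have "((\<lambda>t. (h t / t) ^ 2 * h t ^ (N - 2)) \<longlongrightarrow> \<eta> ^ 2 * 0) (at 0)"
      using NM(3) by (intro tendsto_intros h_sq pow0 h0) auto
    moreover have "(h t / t) ^ 2 * h t ^ (N - 2) = h t ^ N / t ^ 2" for t
    proof -
      have "N = 2 + (N - 2)" using NM(3) by simp
      then have "h t ^ N = h t ^ 2 * h t ^ (N - 2)" by (metis power_add)
      then show ?thesis by (simp add: power_divide)
    qed
    ultimately show ?thesis by simp
  qed
  have "((\<lambda>t. (1 / t ^ 2) *\<^sub>R (h t ^ 2, h t ^ N)) \<longlongrightarrow> (\<eta> ^ 2, 0)) (at 0)"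
    using tendsto_Pair[OF tendsto_power[OF h_sq, of 2] hN] by (simp add: power_divide)
  from tendsto_quotient_imp_bound[OF this]
  have "((\<lambda>t. (1 / t ^ 2) *\<^sub>R (\<Psi> (h t ^ 2, h t ^ N) - \<Psi> 0 - ?D ((h t ^ 2, h t ^ N) - 0))) \<longlongrightarrow> 0) (at 0)"
    by (intro strict_derivative_small[OF \<Psi>(1,2,3,5) u0(1) tendsto_const]) simp
  from tendsto_add[OF tendsto_snd[OF this] tendsto_mult_left[OF hN, of c]]
  have "((\<lambda>t. snd ((1 / t ^ 2) *\<^sub>R f (h t))) \<longlongrightarrow> snd (0 :: real \<times> real) + c * 0) (at 0)"
  proof (rule Lim_transform_eventually)
    show "\<forall>\<^sub>F t in at 0. snd ((1 / t ^ 2) *\<^sub>R (\<Psi> (h t ^ 2, h t ^ N) - \<Psi> 0 - ?D ((h t ^ 2, h t ^ N) - 0)))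
        + c * (h t ^ N / t ^ 2) = snd ((1 / t ^ 2) *\<^sub>R f (h t))"
      using fh by eventually_elim (simp add: \<Psi>(4) diff_divide_distrib)
  qed
  moreover have "((\<lambda>t. snd ((1 / t ^ 2) *\<^sub>R f (h t))) \<longlongrightarrow> snd (E (1, 0))) (at 0)"
  proof -
    have tM: "((\<lambda>t::real. t ^ M / t ^ 2) \<longlongrightarrow> 0) (at 0)"
    proof -
      have "((\<lambda>t::real. t ^ (M - 2)) \<longlongrightarrow> 0) (at 0)"
        using NM by (intro pow0 id0) auto
      then show ?thesis
      proof (rule Lim_transform_eventually)
        show "\<forall>\<^sub>F t::real in at 0. t ^ (M - 2) = t ^ M / t ^ 2"
          using eventually_neq_at_within[of 0 0 UNIV]
          by eventually_elim (use NM in \<open>simp add: power_diff\<close>)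
      qed
    qed
    have "((\<lambda>t::real. t ^ 2 / t ^ 2) \<longlongrightarrow> 1) (at 0)"
    proof (rule Lim_transform_eventually[OF tendsto_const])
      show "\<forall>\<^sub>F t::real in at 0. 1 = t ^ 2 / t ^ 2"
        using eventually_neq_at_within[of 0 0 UNIV] by eventually_elim simp
    qed
    from tendsto_Pair[OF this tM]
    have lim: "((\<lambda>t::real. (1 / t ^ 2) *\<^sub>R (t ^ 2, t ^ M)) \<longlongrightarrow> (1, 0)) (at 0)" by simp
    have u: "((\<lambda>t::real. (t ^ 2, t ^ M)) \<longlongrightarrow> 0) (at 0)"
      using NM by (auto intro!: pair0 pow0 id0)
    from tendsto_quotient_imp_bound[OF lim]
    have "((\<lambda>t. (1 / t ^ 2) *\<^sub>R (\<psi> (t ^ 2, t ^ M) - \<psi> 0 - E ((t ^ 2, t ^ M) - 0))) \<longlongrightarrow> 0) (at 0)"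
      by (intro strict_derivative_small[OF \<psi>(1,2,3,5) u tendsto_const]) simp
    moreover have "((\<lambda>t. E ((1 / t ^ 2) *\<^sub>R (t ^ 2, t ^ M))) \<longlongrightarrow> E (1, 0)) (at 0)"
      by (rule bounded_linear.tendsto[OF linear_linear[THEN iffD2, OF linE] lim])
    ultimately have "((\<lambda>t. (1 / t ^ 2) *\<^sub>R (\<psi> (t ^ 2, t ^ M) - \<psi> 0 - E ((t ^ 2, t ^ M) - 0))
        + E ((1 / t ^ 2) *\<^sub>R (t ^ 2, t ^ M))) \<longlongrightarrow> 0 + E (1, 0)) (at 0)"
      by (rule tendsto_add)
    then have "((\<lambda>t. (1 / t ^ 2) *\<^sub>R f (h t)) \<longlongrightarrow> 0 + E (1, 0)) (at 0)"
    proof (rule Lim_transform_eventually)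
      show "\<forall>\<^sub>F t in at 0. (1 / t ^ 2) *\<^sub>R (\<psi> (t ^ 2, t ^ M) - \<psi> 0 - E ((t ^ 2, t ^ M) - 0))
        + E ((1 / t ^ 2) *\<^sub>R (t ^ 2, t ^ M)) = (1 / t ^ 2) *\<^sub>R f (h t)"
        using eq1 by eventually_elim (simp only: linear_scale[OF linE] \<psi>(4) diff_zero scaleR_diff_right diff_add_cancel)
    qed
    from tendsto_snd[OF this] show ?thesis by simp
  qed
  ultimately have "snd (E (1, 0)) = snd (0 :: real \<times> real) + c * 0"
    using LIM_unique by blast
  then show "snd (E (1, 0)) = 0" by simp
qed

section \<open>Assembly of the two implications\<close>

lemma smooth_map_germ_phi2:
  assumes "smooth_germ \<kappa>"
  shows "smooth_map_germ (phi2 \<kappa>)"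
proof -
  obtain r where "0 < r" "smooth_on (ball 0 r) \<kappa>"
    using assms unfolding smooth_germ_def by (meson open_contains_ball smooth_on_subset)
  then show ?thesis
    unfolding smooth_map_germ_def smooth_germ_def using smooth_phi2 phi2_at_0
    by (meson centre_in_ball open_ball)
qed

lemma smooth_map_germ_cusp: "smooth_map_germ (\<lambda>t::real. (t ^ 2, t ^ (2 * k + 1)))"
proof -
  have "smooth_on UNIV (\<lambda>t::real. (t ^ 2, t ^ (2 * k + 1)))"
    by (intro smooth_on_intros open_UNIV)
  then show ?thesis
    unfolding smooth_map_germ_def smooth_germ_def by (auto simp: zero_prod_def intro!: exI[of _ UNIV])
qed

lemma L_equivalent_imp_A_equivalent:
  assumes "L_equivalent f g"
  shows "A_equivalent f g"
proof -
  have "diffeo_germ (\<lambda>t::real. t)"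
    unfolding diffeo_germ_def
    by (auto intro!: exI[of _ UNIV] exI[of _ "\<lambda>t. t"] homeomorphism_ident smooth_on_ident)
  then show ?thesis
    using assms unfolding L_equivalent_def A_equivalent_def by blast
qed

lemma phi2_L_equivalent_cusp:
  assumes "smooth_germ \<kappa>" "1 \<le> k"
    and "\<And>i. odd i \<Longrightarrow> i < 2 * k - 1 \<Longrightarrow> theta_coeff \<kappa> i = 0"
    and "theta_coeff \<kappa> (2 * k - 1) \<noteq> 0"
  shows "L_equivalent (phi2 \<kappa>) (\<lambda>t. (t ^ 2, t ^ (2 * k + 1)))"
proof -
  obtain U \<Psi> where \<Psi>: "open U" "0 \<in> U" "smooth_on U \<Psi>" "\<Psi> 0 = 0"
    "(\<Psi> has_derivative (\<lambda>p. (fst p / 2,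
      theta_coeff \<kappa> (2 * k - 1) / (fact (2 * k - 1) * real (2 * k + 1)) * snd p))) (at 0)"
    "\<forall>\<^sub>F t in nhds 0. phi2 \<kappa> t = \<Psi> (t ^ 2, t ^ (2 * k + 1))"
    using phi2_normal_form[OF assms(1-3)] by blast
  have "inj (\<lambda>p::real \<times> real. (fst p / 2, theta_coeff \<kappa> (2 * k - 1) / (fact (2 * k - 1) * real (2 * k + 1)) * snd p))"
    using assms(4) by (auto simp: inj_def)
  then have "diffeo_germ \<Psi>"
    by (rule smooth_inverse_function_R2[OF \<Psi>(1-5)])
  then show ?thesis
    unfolding L_equivalent_def using \<Psi>(6) smooth_map_germ_phi2[OF assms(1)] smooth_map_germ_cusp by blast
qed

text \<open>Since \<open>snd (E (1, 0)) = 0\<close>, injectivity of \<open>E\<close> makes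
  \<open>snd (E (0, 1))\<close> nonzero, and \<open>\<eta>\<close> is nonzero because
  \<open>h\<close> is a diffeomorphism germ. So in the comparison of coefficients \<open>c\<close>
  vanishes exactly when the power of 0 on the other side does, that is, for
  \<open>m < k\<close>.\<close>

lemma A_even_singularity_imp_coefficient:
  assumes "smooth_germ \<kappa>" "1 \<le> m" "m \<le> k" "A_even_singularity k (phi2 \<kappa>)"
    and "\<And>i. odd i \<Longrightarrow> i < 2 * m - 1 \<Longrightarrow> theta_coeff \<kappa> i = 0"
  shows "theta_coeff \<kappa> (2 * m - 1) = 0 \<longleftrightarrow> m < k"
proof -
  define c where "c = theta_coeff \<kappa> (2 * m - 1) / (fact (2 * m - 1) * real (2 * m + 1))"
  obtain U \<Psi> where \<Psi>: "open U" "0 \<in> U" "smooth_on U \<Psi>" "\<Psi> 0 = 0"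
    "(\<Psi> has_derivative (\<lambda>p. (fst p / 2, c * snd p))) (at 0)"
    "\<forall>\<^sub>F t in nhds 0. phi2 \<kappa> t = \<Psi> (t ^ 2, t ^ (2 * m + 1))"
    using phi2_normal_form[OF assms(1,2,5)] unfolding c_def by blast
  obtain h \<psi> where h: "diffeo_germ h" and \<psi>: "diffeo_germ \<psi>"
    and eq: "\<forall>\<^sub>F t in nhds 0. phi2 \<kappa> (h t) = \<psi> (t ^ 2, t ^ (2 * k + 1))"
    using assms(4) unfolding A_even_singularity_def A_equivalent_def by blast
  have 0: "h 0 = 0" "\<psi> 0 = 0" using h \<psi> by (auto simp: diffeo_germ_def)
  obtain U' H where H: "open U'" "0 \<in> U'" "smooth_on U' h" "(h has_derivative H) (at 0)" "inj H"
    using diffeo_germ_derivative_inj[OF h] by blast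
  obtain V E where E: "open V" "0 \<in> V" "smooth_on V \<psi>" "(\<psi> has_derivative E) (at 0)" "inj E"
    using diffeo_germ_derivative_inj[OF \<psi>] by blast
  define \<eta> where "\<eta> = deriv h 0"
  have \<eta>: "(h has_real_derivative \<eta>) (at 0)"
    unfolding \<eta>_def by (rule smooth_on_deriv(1)[OF H(1,3,2)])
  then have "H = (*) \<eta>"
    using H(4) has_derivative_unique unfolding has_field_derivative_def by blast
  then have "\<eta> \<noteq> 0" using injD[OF H(5), of 0 1] by auto
  have coeff: "c * \<eta> ^ (2 * m + 1) = 0 ^ (2 * k + 1 - (2 * m + 1)) * snd (E (0, 1))" "snd (E (1, 0)) = 0"
    by (rule cusp_equivalence_coefficient[OF \<Psi> \<eta> 0(1) E(1-3) 0(2) E(4) eq]; use assms(2,3) in simp)+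
  have "snd (E (0, 1)) \<noteq> 0"
  proof
    assume w: "snd (E (0, 1)) = 0"
    have linE: "linear E" using E(4) has_derivative_linear by blast
    have split: "E (x, y) = x *\<^sub>R E (1, 0) + y *\<^sub>R E (0, 1)" for x y
      using linear_add[OF linE, of "(x, 0)" "(0, y)"] linear_scale[OF linE, of x "(1, 0)"]
        linear_scale[OF linE, of y "(0, 1)"] by simp
    \<comment> \<open>If both images are horizontal, this combination of them is 0. Injectivity
      makes its coefficients 0, which leaves \<open>E (1, 0) = 0\<close>.\<close>
    have "E (fst (E (0, 1)), - fst (E (1, 0))) = E (0, 0)"
      using w coeff(2) by (simp add: split[of "fst (E (0, 1))"] split[of 0 0] prod_eq_iff)
    from injD[OF E(5) this] have "E (1, 0) = E (0, 0)"
      using coeff(2) by (simp add: split[of 0 0] prod_eq_iff)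
    from injD[OF E(5) this] show False by simp
  qed
  then have "c = 0 \<longleftrightarrow> m < k"
    using coeff(1) \<open>\<eta> \<noteq> 0\<close> assms(3) by (cases "m = k") (auto simp: power_0_left)
  then show ?thesis by (simp add: c_def)
qed

theorem theorem3p2:
  fixes k :: nat and \<kappa> :: "real \<Rightarrow> real"
  assumes "k \<ge> 1"
    and "smooth_germ \<kappa>"
  shows "(A_even_singularity k (phi2 \<kappa>) \<longleftrightarrow>
            (\<forall>i\<ge>1. i mod 2 \<noteq> 0 \<and> i < 2 * k - 1 \<longrightarrow> theta_coeff \<kappa> i = 0) \<and>
            theta_coeff \<kappa> (2 * k - 1) \<noteq> 0)
       \<and> ((\<forall>i\<ge>1. i mod 2 \<noteq> 0 \<and> i < 2 * k - 1 \<longrightarrow> theta_coeff \<kappa> i = 0) \<and>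
            theta_coeff \<kappa> (2 * k - 1) \<noteq> 0 \<longrightarrow>
          L_equivalent (phi2 \<kappa>) (\<lambda>t. (t ^ 2, t ^ (2 * k + 1))))"
proof -
  let ?C = "(\<forall>i\<ge>1. i mod 2 \<noteq> 0 \<and> i < 2 * k - 1 \<longrightarrow> theta_coeff \<kappa> i = 0) \<and>
    theta_coeff \<kappa> (2 * k - 1) \<noteq> 0"
  have L: "L_equivalent (phi2 \<kappa>) (\<lambda>t. (t ^ 2, t ^ (2 * k + 1)))" if ?C
  proof (rule phi2_L_equivalent_cusp[OF assms(2,1)])
    show "theta_coeff \<kappa> i = 0" if "odd i" "i < 2 * k - 1" for i
      using \<open>?C\<close> that odd_pos[of i] by (auto simp: odd_iff_mod_2_eq_one)
  qed (use that in blast)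
  have "?C" if A: "A_even_singularity k (phi2 \<kappa>)"
  proof -
    \<comment> \<open>Stated for every \<open>m \<le> k\<close>: vanishing below
      \<open>2 * m - 1\<close> is what the normal form of order \<open>m\<close> requires, and for
      \<open>m < k\<close> it yields the next odd coefficient.\<close>
    have odd_zero: "theta_coeff \<kappa> i = 0" if "1 \<le> m" "m \<le> k" "odd i" "i < 2 * m - 1" for m i
      using that
    proof (induction m arbitrary: i rule: dec_induct)
      case base
      then show ?case by simp
    next
      case (step m)
      show ?case
      proof (cases "i < 2 * m - 1")
        case True
        then show ?thesis using step by simp
      next
        case False
        then have "i = 2 * m - 1" using step.prems(2,3) by presburger
        then show ?thesis
          using A_even_singularity_imp_coefficient[OF assms(2) step.hyps(1) _ A step.IH] step.prems(1)
          by simp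
      qed
    qed
    have "theta_coeff \<kappa> (2 * k - 1) \<noteq> 0"
      using A_even_singularity_imp_coefficient[OF assms(2,1) order_refl A odd_zero[OF assms(1) order_refl]]
      by simp
    then show ?C
      using odd_zero[OF assms(1) order_refl] by (auto simp: odd_iff_mod_2_eq_one)
  qed
  moreover have "A_even_singularity k (phi2 \<kappa>)" if ?C
    unfolding A_even_singularity_def by (rule L_equivalent_imp_A_equivalent[OF L[OF that]])
  ultimately show ?thesis using L by blast
qed

end
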